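(* Let $G$ be a planar graph. If $G$ has girth at least $8$, then $\operatorname{diam}(\mathcal{I}(G)) \leq 3$.
   Context: Graphs are finite and simple. The girth of a graph is the length of its shortest cycle (infinite if there is no cycle). In an orientation $\vec{G}$ of a graph $G$, the inversion of a set $X \subseteq V(G)$ consists in reversing all arcs with both endvertices in $X$. The inversion graph $\mathcal{I}(G)$ is the graph whose vertices are the labelled orientations of $G$, two orientations being adjacent if and only if the inversion of some $X\subseteq V(G)$ transforms one into the other; $\operatorname{diam}(\mathcal{I}(G))$ is its diameter. *)

theory Defs
  imports
    "HOL-Analysis.Analysis"
    "HOL-Library.Extended_Nat"
    "Graph_Theory.Graph_Theory"
begin

text \<open>
  A finite simple graph is a \<^term>\<open>pair_graph\<close> of the Graph-Theory library: each edge is represented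
  by its two opposite arcs.  Since \<^term>\<open>pre_digraph.cycle\<close> is the notion for digraphs, going back and
  forth along one edge counts as a cycle of length 2 there; the cycles of the graph are those of
  length at least 3.
\<close>

definition girth :: "('a, 'b) pre_digraph \<Rightarrow> enat" where
  "girth G = (INF c \<in> {c. pre_digraph.cycle G c \<and> 3 \<le> length c}. enat (length c))"

definition diam :: "('a, 'b) pre_digraph \<Rightarrow> ereal" where
  "diam G = (SUP u \<in> verts G. SUP v \<in> verts G. wf_digraph.\<mu> G (\<lambda>_. 1) u v)"

text \<open>
  A drawing in the plane places the vertices by \<open>p\<close> and represents the edge \<open>{u, v}\<close> by the
  arc \<open>g {u, v}\<close>.
\<close>

definition plane_drawing ::
    "'a pair_pre_digraph \<Rightarrow> ('a \<Rightarrow> complex) \<Rightarrow> ('a set \<Rightarrow> real \<Rightarrow> complex) \<Rightarrow> bool" where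
  "plane_drawing G p g \<longleftrightarrow>
     inj_on p (pverts G) \<and>
     (\<forall>(u, v) \<in> parcs G.
        arc (g {u, v}) \<and>
        {pathstart (g {u, v}), pathfinish (g {u, v})} = {p u, p v} \<and>
        path_image (g {u, v}) \<inter> p ` pverts G = {p u, p v}) \<and>
     (\<forall>(u, v) \<in> parcs G. \<forall>(x, y) \<in> parcs G.
        {u, v} \<noteq> {x, y} \<longrightarrow>
        path_image (g {u, v}) \<inter> path_image (g {x, y}) \<subseteq> p ` ({u, v} \<inter> {x, y}))"

definition planar :: "'a pair_pre_digraph \<Rightarrow> bool" where
  "planar G \<longleftrightarrow> (\<exists>p g. plane_drawing G p g)"

definition orientation :: "'a pair_pre_digraph \<Rightarrow> 'a pair_pre_digraph \<Rightarrow> bool" where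
  "orientation G D \<longleftrightarrow>
     pverts D = pverts G \<and> parcs D \<subseteq> parcs G \<and>
     (\<forall>(u, v) \<in> parcs G. (u, v) \<in> parcs D \<longleftrightarrow> (v, u) \<notin> parcs D)"

definition inversion :: "'a set \<Rightarrow> 'a pair_pre_digraph \<Rightarrow> 'a pair_pre_digraph" where
  "inversion X D =
     \<lparr> pverts = pverts D,
       parcs = {(u, v). if u \<in> X \<and> v \<in> X then (v, u) \<in> parcs D else (u, v) \<in> parcs D} \<rparr>"

definition inversion_graph :: "'a pair_pre_digraph \<Rightarrow> 'a pair_pre_digraph pair_pre_digraph" where
  "inversion_graph G =
     \<lparr> pverts = {D. orientation G D},
       parcs = {(D, D'). orientation G D \<and> orientation G D' \<and> D \<noteq> D' \<and>
                  (\<exists>X \<subseteq> pverts G. inversion X D = D')} \<rparr>"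

lemma inversion_inversion: "inversion X (inversion X D) = D"
  by (cases D) (auto simp: inversion_def split: if_splits)

lemma pair_graph_inversion_graph:
  assumes "pair_graph G"
  shows "pair_graph (inversion_graph G)"
proof -
  interpret pair_graph G by fact
  have "{D. orientation G D} \<subseteq> (\<lambda>A. \<lparr> pverts = pverts G, parcs = A \<rparr>) ` Pow (parcs G)"
  proof
    fix D assume "D \<in> {D. orientation G D}"
    then show "D \<in> (\<lambda>A. \<lparr> pverts = pverts G, parcs = A \<rparr>) ` Pow (parcs G)"
      by (intro image_eqI[where x = "parcs D"]) (auto simp: orientation_def)
  qed
  then have fin: "finite {D. orientation G D}"
    by (rule finite_subset) (use pair_finite_arcs in auto)
  have "parcs (inversion_graph G) \<subseteq> {D. orientation G D} \<times> {D. orientation G D}"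
    by (auto simp: inversion_graph_def)
  then have fin': "finite (parcs (inversion_graph G))"
    by (rule finite_subset) (use fin in auto)
  show ?thesis
  proof
    show "finite (pverts (inversion_graph G))" using fin by (simp add: inversion_graph_def)
    show "finite (parcs (inversion_graph G))" by (rule fin')
    show "symmetric (with_proj (inversion_graph G))"
      by (auto simp: symmetric_def sym_def inversion_graph_def inversion_inversion)
  qed (auto simp: inversion_graph_def)
qed

end

theory Submission
  imports Defs
begin

text \<open>
  Three inversions suffice as soon as every \<open>\<pi> : E \<rightarrow> F\<^sub>2\<close> can be written as \<open>\<pi>(uv) = x\<^sub>u \<cdot> x\<^sub>v\<close> with
  vectors \<open>x\<^sub>v \<in> F\<^sub>2\<^sup>3\<close>: the i-th inverted set consists of the vertices whose i-th coordinate is 1.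
  Asking for nonzero vectors makes three configurations reducible: a vertex of degree at most 1, two
  adjacent vertices of degree 2, and a vertex of degree 3 with two neighbours of degree 2. If none
  occurs, letting every vertex of degree 2 receive 1/3 from each neighbour shows that the average
  degree is at least 8/3, whereas \<open>3|E| < 4|V|\<close> in a planar graph of girth at least 8.

  The edge bound for girth \<open>k\<close>, \<open>(k - 2)|E| + k \<le> k|V|\<close>, is obtained from the Jordan curve theorem
  without counting faces. If the whole graph is drawn in the closed inside of one of its cycles \<open>C\<close>,
  then even \<open>(k - 2)|E| + k + |C| \<le> k|V|\<close>: an ear of \<open>C\<close> splits the disc into two smaller ones, and
  without ears the components of \<open>E - E(C)\<close> contain at most one vertex of \<open>C\<close> each, so that the general
  bound for smaller graphs applies to them. For a graph with a cycle \<open>C\<close>, the disc bound is applied to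
  the part inside \<open>C\<close> and, after the map \<open>z \<mapsto> 1/(z - a)\<close> with \<open>a\<close> inside \<open>C\<close>, to the part outside.
\<close>

section \<open>Paths and cycles\<close>

text \<open>Edges are two-element sets, the type by which \<open>plane_drawing\<close> indexes the
  arcs \<open>g\<close>. The vertex set is kept apart from the edges, since isolated vertices count
  in the bounds below.\<close>

definition sgraph :: "'a set \<Rightarrow> 'a set set \<Rightarrow> bool" where
  "sgraph V E \<longleftrightarrow> finite V \<and> (\<forall>e\<in>E. \<exists>u\<in>V. \<exists>v\<in>V. u \<noteq> v \<and> e = {u, v})"

fun path_edges :: "'a list \<Rightarrow> 'a set set" where
  "path_edges (u # v # vs) = insert {u, v} (path_edges (v # vs))"
| "path_edges _ = {}"

definition cycle_edges :: "'a list \<Rightarrow> 'a set set" where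
  "cycle_edges C = path_edges (C @ [hd C])"

text \<open>For a list of two vertices \<open>cycle_edges\<close> collapses to a single edge, hence
  the bound 3 on the length.\<close>

definition cycle_in :: "'a set set \<Rightarrow> 'a list \<Rightarrow> bool" where
  "cycle_in E C \<longleftrightarrow> distinct C \<and> 3 \<le> length C \<and> cycle_edges C \<subseteq> E"

lemma sgraph_edgeE:
  assumes "sgraph V E" "e \<in> E"
  obtains u v where "u \<in> V" "v \<in> V" "u \<noteq> v" "e = {u, v}"
  using assms unfolding sgraph_def by meson

lemma sgraph_edge_subset: "sgraph V E \<Longrightarrow> e \<in> E \<Longrightarrow> e \<subseteq> V"
  by (auto simp: sgraph_def)

lemma sgraph_finite_edges:
  assumes "sgraph V E"
  shows "finite E"
proof (rule finite_subset)
  show "E \<subseteq> Pow V" using sgraph_edge_subset[OF assms] by auto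
  show "finite (Pow V)" using assms by (simp add: sgraph_def)
qed

lemma sgraph_subgraph:
  assumes "sgraph V E" "V' \<subseteq> V" "E' \<subseteq> E" "\<And>e. e \<in> E' \<Longrightarrow> e \<subseteq> V'"
  shows "sgraph V' E'"
  unfolding sgraph_def
proof (intro conjI ballI)
  show "finite V'" using assms(1,2) by (auto simp: sgraph_def intro: finite_subset)
  fix e assume "e \<in> E'"
  then obtain u v where "u \<noteq> v" "e = {u, v}" using sgraph_edgeE[OF assms(1)] assms(3) by (metis subsetD)
  with assms(4)[OF \<open>e \<in> E'\<close>] show "\<exists>u\<in>V'. \<exists>v\<in>V'. u \<noteq> v \<and> e = {u, v}" by auto
qed

lemma path_edges_append:
  "path_edges (xs @ a # ys) = path_edges (xs @ [a]) \<union> path_edges (a # ys)"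
  by (induction xs rule: path_edges.induct) auto

lemma path_edges_append_subsets:
  "path_edges xs \<subseteq> path_edges (xs @ ys)" "path_edges ys \<subseteq> path_edges (xs @ ys)"
proof -
  show "path_edges xs \<subseteq> path_edges (xs @ ys)"
    by (induction xs rule: path_edges.induct) auto
  show "path_edges ys \<subseteq> path_edges (xs @ ys)"
    using path_edges_append by (cases ys) fastforce+
qed

lemma path_edges_rev: "path_edges (rev xs) = path_edges xs"
proof (induction xs rule: path_edges.induct)
  case (1 u v vs)
  then show ?case
    using path_edges_append[of "rev vs" v "[u]"] by (simp add: insert_commute)
qed auto

lemma path_edge_subset: "e \<in> path_edges vs \<Longrightarrow> e \<subseteq> set vs"
  by (induction vs rule: path_edges.induct) auto

lemma Union_path_edges: "2 \<le> length vs \<Longrightarrow> \<Union> (path_edges vs) = set vs"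
proof (induction vs rule: path_edges.induct)
  case (1 u v vs)
  then show ?case by (cases vs) auto
qed auto

lemma finite_path_edges: "finite (path_edges vs)"
  by (induction vs rule: path_edges.induct) auto

lemma card_path_edges: "distinct vs \<Longrightarrow> card (path_edges vs) = length vs - 1"
proof (induction vs rule: path_edges.induct)
  case (1 u v vs)
  then have "{u, v} \<notin> path_edges (v # vs)" using path_edge_subset by fastforce
  with 1 show ?case by (simp add: finite_path_edges)
qed auto

lemma path_edges_ends:
  assumes "distinct (a # xs @ [b])" "{a, b} \<in> path_edges (a # xs @ [b])"
  shows "xs = []"
proof (cases xs)
  case (Cons x xs')
  with assms have "{a, b} \<in> path_edges (x # xs' @ [b])" by (auto simp: doubleton_eq_iff)
  from path_edge_subset[OF this] show ?thesis using assms Cons by auto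
qed

lemma path_edge_doubleton: "distinct vs \<Longrightarrow> e \<in> path_edges vs \<Longrightarrow> \<exists>u v. u \<noteq> v \<and> e = {u, v}"
  by (induction vs rule: path_edges.induct) auto

text \<open>A common edge lies in both vertex sets and so equals \<open>{a, b}\<close>; by
  \<open>path_edges_ends\<close> neither path then has an inner vertex, which the second hypothesis
  excludes.\<close>

lemma path_edges_disjoint:
  assumes "distinct (a # b # xs @ ys)" "xs \<noteq> [] \<or> ys \<noteq> []"
  shows "path_edges (a # xs @ [b]) \<inter> path_edges (a # ys @ [b]) = {}"
proof (rule ccontr)
  assume "\<not> ?thesis"
  then obtain e where e: "e \<in> path_edges (a # xs @ [b])" "e \<in> path_edges (a # ys @ [b])" by blast
  have d: "distinct (a # xs @ [b])" "distinct (a # ys @ [b])" using assms(1) by auto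
  obtain u v where uv: "u \<noteq> v" "e = {u, v}" using path_edge_doubleton[OF d(1) e(1)] by blast
  have "e \<subseteq> {a, b}" using path_edge_subset[OF e(1)] path_edge_subset[OF e(2)] assms(1) by auto
  with uv have "e = {a, b}" by auto
  then show False using path_edges_ends[OF d(1)] path_edges_ends[OF d(2)] e assms(2) by simp
qed

text \<open>One path is traversed forwards and the other backwards. An inner vertex on either of
  them guarantees the three vertices required by \<open>cycle_in\<close>.\<close>

lemma cycle_joinE:
  assumes "distinct (a # b # xs @ ys)" "xs \<noteq> [] \<or> ys \<noteq> []"
    and "path_edges (a # xs @ [b]) \<union> path_edges (a # ys @ [b]) \<subseteq> E"
  obtains C where "cycle_in E C" "set C = {a, b} \<union> set xs \<union> set ys"
    "length C = length xs + length ys + 2"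
    "cycle_edges C = path_edges (a # xs @ [b]) \<union> path_edges (a # ys @ [b])"
proof -
  let ?C = "a # xs @ b # rev ys"
  have *: "cycle_edges ?C = path_edges (a # xs @ [b]) \<union> path_edges (a # ys @ [b])"
    using path_edges_append[of "a # xs" b "rev ys @ [a]"] path_edges_rev[of "a # ys @ [b]"]
    by (simp add: cycle_edges_def)
  have "cycle_in E ?C"
    using assms * by (cases xs; cases ys) (auto simp: cycle_in_def)
  with * show ?thesis by (intro that[of ?C]) auto
qed

lemma cycle_edges_rotate:
  assumes "us \<noteq> []" "vs \<noteq> []"
  shows "cycle_edges (us @ vs) = cycle_edges (vs @ us)"
proof -
  obtain u us' v vs' where eq: "us = u # us'" "vs = v # vs'" using assms by (meson list.exhaust)
  have "cycle_edges (us @ vs) = path_edges (us @ [v]) \<union> path_edges (vs @ [u])"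
    using path_edges_append[of us v "vs' @ [u]"] by (simp add: cycle_edges_def eq)
  moreover have "cycle_edges (vs @ us) = path_edges (vs @ [u]) \<union> path_edges (us @ [v])"
    using path_edges_append[of vs u "us' @ [v]"] by (simp add: cycle_edges_def eq)
  ultimately show ?thesis by auto
qed

text \<open>The converse of \<open>cycle_joinE\<close>: rotate the cycle to start at
  \<open>a\<close> and cut it at \<open>b\<close>. The length and the drawing of a cycle are later
  read off from the two paths.\<close>

lemma cycle_splitE:
  assumes "cycle_in E C" "a \<in> set C" "b \<in> set C" "a \<noteq> b"
  obtains xs ys where "distinct (a # b # xs @ ys)" "xs \<noteq> [] \<or> ys \<noteq> []"
    "set C = {a, b} \<union> set xs \<union> set ys" "length C = length xs + length ys + 2"
    "cycle_edges C = path_edges (a # xs @ [b]) \<union> path_edges (a # ys @ [b])"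
proof -
  obtain us vs where C: "C = us @ a # vs" using assms(2) by (meson split_list)
  have b: "b \<in> set (vs @ us)" using assms(3,4) C by auto
  then obtain xs zs where D: "vs @ us = xs @ b # zs" by (meson split_list)
  have "cycle_edges C = cycle_edges (a # vs @ us)"
    by (cases "us = []") (use cycle_edges_rotate[of us "a # vs"] C in auto)
  also have "\<dots> = path_edges (a # xs @ [b]) \<union> path_edges (a # rev zs @ [b])"
    using path_edges_append[of "a # xs" b "zs @ [a]"] path_edges_rev[of "a # rev zs @ [b]"]
    by (simp add: cycle_edges_def D)
  finally have ce: "cycle_edges C = path_edges (a # xs @ [b]) \<union> path_edges (a # rev zs @ [b])" .
  have "set C = insert a (set (vs @ us))" "distinct (a # vs @ us)" "length C = Suc (length (vs @ us))"
    using C assms(1) by (auto simp: cycle_in_def)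
  then show ?thesis
    using ce assms(1) unfolding D by (intro that[of xs "rev zs"]) (auto simp: cycle_in_def)
qed

lemma card_cycle_edges:
  assumes "cycle_in E C"
  shows "card (cycle_edges C) = length C"
proof -
  obtain a b D where C: "C = a # b # D"
    using assms by (cases C rule: path_edges.cases) (auto simp: cycle_in_def)
  have "a \<in> set C" "b \<in> set C" "a \<noteq> b" using assms C by (auto simp: cycle_in_def)
  from cycle_splitE[OF assms this] obtain xs ys where
    *: "distinct (a # b # xs @ ys)" "xs \<noteq> [] \<or> ys \<noteq> []" "length C = length xs + length ys + 2"
      "cycle_edges C = path_edges (a # xs @ [b]) \<union> path_edges (a # ys @ [b])" .
  have "card (cycle_edges C) = card (path_edges (a # xs @ [b])) + card (path_edges (a # ys @ [b]))"
    unfolding *(4) by (rule card_Un_disjoint) (use finite_path_edges path_edges_disjoint[OF *(1,2)] in auto)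
  also have "\<dots> = length C"
    by (subst (1 2) card_path_edges) (use * in auto)
  finally show ?thesis .
qed

lemma Union_cycle_edges: "cycle_in E C \<Longrightarrow> \<Union> (cycle_edges C) = set C"
  unfolding cycle_edges_def by (subst Union_path_edges) (cases C; auto simp: cycle_in_def)+

section \<open>Walks, ears and forests\<close>

lemma reachable_imp_walk:
  assumes "(u, v) \<in> {(x, y). {x, y} \<in> F}\<^sup>*"
  shows "\<exists>w. w \<noteq> [] \<and> hd w = u \<and> last w = v \<and> path_edges w \<subseteq> F"
  using assms
proof (induction rule: converse_rtrancl_induct)
  case base
  show ?case by (rule exI[of _ "[v]"]) simp
next
  case (step x y)
  then obtain w where w: "w \<noteq> []" "hd w = y" "last w = v" "path_edges w \<subseteq> F" by blast
  then show ?case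
    by (intro exI[of _ "x # w"]) (use step(1) in \<open>cases w; auto\<close>)
qed

text \<open>A shortest walk in \<open>F\<close> among those joining two distinct vertices of
  \<open>S\<close> is an ear: a repeated vertex allows a shortcut, and an inner vertex in
  \<open>S\<close> ends a shorter walk of the same kind.\<close>

lemma reachable_imp_ear:
  assumes "(u, v) \<in> {(x, y). {x, y} \<in> F}\<^sup>*" "u \<in> S" "v \<in> S" "u \<noteq> v"
  obtains a ps b where "a \<in> S" "b \<in> S" "distinct (a # ps @ [b])" "set ps \<inter> S = {}"
    "path_edges (a # ps @ [b]) \<subseteq> F"
proof -
  define P where "P w \<longleftrightarrow> w \<noteq> [] \<and> hd w \<in> S \<and> last w \<in> S \<and> hd w \<noteq> last w \<and> path_edges w \<subseteq> F" for w
  have "\<exists>w. P w" using reachable_imp_walk[OF assms(1)] assms(2-4) unfolding P_def by metis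
  then obtain w where w: "P w" and min: "\<And>w'. P w' \<Longrightarrow> length w \<le> length w'"
    by (metis ex_has_least_nat)
  obtain a b ps where w_eq: "w = a # ps @ [b]"
    using w unfolding P_def by (cases w; cases "tl w" rule: rev_cases) auto
  have "distinct w"
  proof (rule ccontr)
    assume "\<not> distinct w"
    then obtain xs y ys zs where d: "w = xs @ [y] @ ys @ [y] @ zs" using not_distinct_decomp[of w] by blast
    have "P (xs @ y # zs)"
      using w path_edges_append_subsets(2)[of "y # zs" "y # ys"] path_edges_append[of xs y zs]
        path_edges_append[of xs y "ys @ y # zs"]
      unfolding P_def d by (cases xs; cases zs rule: rev_cases) auto
    from min[OF this] show False by (simp add: d)
  qed
  moreover have "set ps \<inter> S = {}"
  proof (rule ccontr)
    assume "set ps \<inter> S \<noteq> {}"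
    then obtain s where s: "s \<in> set ps" "s \<in> S" by blast
    then obtain xs ys where ps: "ps = xs @ s # ys" by (meson split_list)
    \<comment> \<open>\<open>distinct w\<close> gives \<open>a \<noteq> s\<close>, so the prefix
      still has distinct ends.\<close>
    have "P (a # xs @ [s])"
      using w s \<open>distinct w\<close> path_edges_append[of "a # xs" s "ys @ [b]"]
      unfolding P_def w_eq ps by auto
    from min[OF this] show False by (simp add: w_eq ps)
  qed
  ultimately show ?thesis using w unfolding P_def w_eq by (intro that[of a b ps]) auto
qed

text \<open>The first vertex of a longest path has all its neighbours on the path; one of them is
  not the second vertex and closes a cycle.\<close>

lemma min_degree_2_imp_cycle:
  assumes "sgraph V E" "V \<noteq> {}"
    and deg: "\<And>v. v \<in> V \<Longrightarrow> \<exists>u w. u \<noteq> w \<and> {v, u} \<in> E \<and> {v, w} \<in> E"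
  shows "\<exists>C. cycle_in E C"
proof -
  have fin: "finite V" using assms(1) by (simp add: sgraph_def)
  define P where "P w \<longleftrightarrow> w \<noteq> [] \<and> distinct w \<and> set w \<subseteq> V \<and> path_edges w \<subseteq> E" for w
  obtain v0 where "v0 \<in> V" using assms(2) by blast
  then have "P [v0]" by (auto simp: P_def)
  moreover have "\<forall>w. P w \<longrightarrow> length w < Suc (card V)"
    using fin by (auto simp: P_def less_Suc_eq_le intro: card_mono simp flip: distinct_card)
  ultimately obtain w where w: "P w" and max: "\<And>w'. P w' \<Longrightarrow> length w' \<le> length w"
    by (metis ex_has_greatest_nat)
  obtain v vs where w_eq: "w = v # vs" using w by (cases w) (auto simp: P_def)
  have "v \<in> V" using w w_eq by (auto simp: P_def)
  then obtain u where u: "{v, u} \<in> E" "vs \<noteq> [] \<Longrightarrow> u \<noteq> hd vs" using deg by metis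
  have "u \<in> V" "u \<noteq> v"
    using u(1) assms(1) by (auto simp: sgraph_def doubleton_eq_iff)
  have "u \<in> set vs"
  proof (rule ccontr)
    assume "u \<notin> set vs"
    then have "P (u # w)"
      using w \<open>u \<in> V\<close> \<open>u \<noteq> v\<close> u(1) by (auto simp: P_def w_eq insert_commute)
    from max[OF this] show False by simp
  qed
  then obtain xs ys where vs: "vs = xs @ u # ys" by (meson split_list)
  have xs: "xs \<noteq> []" using u(2) vs by auto
  have "path_edges (v # xs @ [u]) \<subseteq> path_edges w"
    using path_edges_append[of "v # xs" u ys] by (auto simp: w_eq vs)
  \<comment> \<open>The chord \<open>{v, u}\<close> is the path from \<open>v\<close> to
    \<open>u\<close> without inner vertices, so that \<open>cycle_joinE\<close> applies with
    \<open>ys = []\<close>.\<close>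
  then have "path_edges (v # xs @ [u]) \<union> path_edges (v # [] @ [u]) \<subseteq> E"
    using w u(1) by (auto simp: P_def)
  moreover have "distinct (v # u # xs @ [])" using w by (auto simp: P_def w_eq vs)
  ultimately show ?thesis using cycle_joinE[of v u xs "[]" E] xs by metis
qed

text \<open>Induction: by \<open>min_degree_2_imp_cycle\<close> some vertex has at most one
  neighbour, and deleting it costs at most one edge \<open>f\<close>.\<close>

lemma forest_card:
  assumes "sgraph V E" "V \<noteq> {}" "\<And>C. \<not> cycle_in E C"
  shows "card E + 1 \<le> card V"
  using assms
proof (induction "card V" arbitrary: V E rule: less_induct)
  case less
  have fin: "finite V" using less.prems(1) by (simp add: sgraph_def)
  obtain v where v: "v \<in> V" "\<And>u w. {v, u} \<in> E \<Longrightarrow> {v, w} \<in> E \<Longrightarrow> u = w"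
    using min_degree_2_imp_cycle[OF less.prems(1,2)] less.prems(3) by metis
  define E' where "E' = {e \<in> E. v \<notin> e}"
  have sub: "sgraph (V - {v}) E'"
    by (rule sgraph_subgraph[OF less.prems(1)])
      (use sgraph_edge_subset[OF less.prems(1)] in \<open>auto simp: E'_def\<close>)
  have "\<exists>f. E \<subseteq> insert f E'"
  proof (cases "\<exists>u. {v, u} \<in> E")
    case True
    then obtain u where u: "{v, u} \<in> E" by blast
    have "e = {v, u}" if e: "e \<in> E" "v \<in> e" for e
    proof -
      obtain x y where "e = {x, y}" using sgraph_edgeE[OF less.prems(1) e(1)] by metis
      then have "\<exists>x. e = {v, x}" using e(2) by auto
      then show ?thesis using v(2)[OF u] e(1) by blast
    qed
    then show ?thesis by (auto simp: E'_def)
  next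
    case False
    have "E \<subseteq> E'"
    proof
      fix e assume e: "e \<in> E"
      obtain x y where "e = {x, y}" using sgraph_edgeE[OF less.prems(1) e] by metis
      then show "e \<in> E'" using False e by (auto simp: E'_def insert_commute)
    qed
    then show ?thesis by auto
  qed
  then obtain f where "E \<subseteq> insert f E'" ..
  then have "card E \<le> card (insert f E')"
    using sgraph_finite_edges[OF sub] by (intro card_mono) auto
  also have "\<dots> \<le> Suc (card E')"
    using sgraph_finite_edges[OF sub] by (simp add: card_insert_if)
  finally have cE: "card E \<le> Suc (card E')" .
  have cV: "card V = Suc (card (V - {v}))" using card.remove[OF fin v(1)] .
  show ?case
  proof (cases "V - {v} = {}")
    case True
    then have "V = {v}" using v(1) by blast
    moreover have "E = {}"
    proof (rule equals0I)
      fix e assume "e \<in> E"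
      then obtain x y where "x \<in> V" "y \<in> V" "x \<noteq> y" using sgraph_edgeE[OF less.prems(1)] by metis
      then show False using \<open>V = {v}\<close> by simp
    qed
    ultimately show ?thesis by simp
  next
    case False
    have "\<not> cycle_in E' C" for C
      using less.prems(3)[of C] unfolding E'_def cycle_in_def by blast
    then have "card E' + 1 \<le> card (V - {v})"
      using less.hyps[OF _ sub False] unfolding cV by simp
    then show ?thesis using cE cV by simp
  qed
qed

section \<open>Labelling sparse graphs by vectors\<close>

type_synonym vec3 = "bool \<times> bool \<times> bool"

abbreviation zero3 :: vec3 where "zero3 \<equiv> (False, False, False)"

fun dot :: "vec3 \<Rightarrow> vec3 \<Rightarrow> bool" where
  "dot (a, b, c) (d, e, f) = ((a \<and> d) \<noteq> ((b \<and> e) \<noteq> (c \<and> f)))"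

lemma dot_commute: "dot x y = dot y x"
  by (cases x; cases y) auto

text \<open>Distinct nonzero vectors over F_2 are linearly independent, so the two equations leave
  exactly two solutions, of which at most one is zero.\<close>

lemma dot_solve_two:
  assumes "x \<noteq> zero3" "y \<noteq> zero3" "x \<noteq> y"
  shows "\<exists>z. z \<noteq> zero3 \<and> dot z x = p \<and> dot z y = q"
  using assms
  by (cases x; cases y; cases p; cases q) (auto simp: split_paired_Ex ex_bool_eq)

text \<open>One equation with a nonzero coefficient vector has four solutions, and at most three
  vectors are excluded.\<close>

lemma dot_solve_avoiding:
  assumes "x \<noteq> zero3"
  shows "\<exists>z. z \<noteq> zero3 \<and> z \<noteq> s \<and> z \<noteq> t \<and> dot z x = p"
proof -
  obtain a b c where x: "x = (a, b, c)" by (cases x)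
  obtain d e f where s: "s = (d, e, f)" by (cases s)
  obtain g h i where t: "t = (g, h, i)" by (cases t)
  show ?thesis using assms unfolding x s t
    by (cases a; cases b; cases c; cases p; simp add: split_paired_Ex ex_bool_eq; argo)
qed

section \<open>Degrees and discharging\<close>

definition nbrs :: "'a set set \<Rightarrow> 'a \<Rightarrow> 'a set" where
  "nbrs E v = {u. {u, v} \<in> E}"

lemma in_nbrs_iff: "u \<in> nbrs E v \<longleftrightarrow> {u, v} \<in> E"
  by (simp add: nbrs_def)

lemma nbrs_sym: "u \<in> nbrs E v \<longleftrightarrow> v \<in> nbrs E u"
  by (simp add: nbrs_def insert_commute)

lemma nbrs_subset:
  assumes "sgraph V E"
  shows "nbrs E v \<subseteq> V - {v}"
proof
  fix u assume "u \<in> nbrs E v"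
  then obtain x y where "x \<in> V" "y \<in> V" "x \<noteq> y" "{u, v} = {x, y}"
    using assms by (auto simp: sgraph_def nbrs_def)
  then show "u \<in> V - {v}" by (auto simp: doubleton_eq_iff)
qed

lemma finite_nbrs: "sgraph V E \<Longrightarrow> finite (nbrs E v)"
  using nbrs_subset[of V E v] by (auto simp: sgraph_def intro: finite_subset)

lemma sum_card_flip:
  assumes "finite A" "finite B"
  shows "(\<Sum>a\<in>A. card {b \<in> B. R a b}) = (\<Sum>b\<in>B. card {a \<in> A. R a b})"
proof -
  have "(\<Sum>a\<in>A. card {b \<in> B. R a b}) = (\<Sum>a\<in>A. \<Sum>b\<in>B. if R a b then 1 else 0)"
    using assms by (simp add: sum.If_cases Int_def)
  also have "\<dots> = (\<Sum>b\<in>B. \<Sum>a\<in>A. if R a b then 1 else 0)" by (rule sum.swap)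
  also have "\<dots> = (\<Sum>b\<in>B. card {a \<in> A. R a b})"
    using assms by (simp add: sum.If_cases Int_def)
  finally show ?thesis .
qed

lemma handshake:
  assumes "sgraph V E"
  shows "(\<Sum>v\<in>V. card (nbrs E v)) = 2 * card E"
proof -
  have "card (nbrs E v) = card {e \<in> E. v \<in> e}" if "v \<in> V" for v
  proof (rule bij_betw_same_card)
    show "bij_betw (\<lambda>u. {u, v}) (nbrs E v) {e \<in> E. v \<in> e}"
      unfolding bij_betw_def
    proof
      show "inj_on (\<lambda>u. {u, v}) (nbrs E v)" by (auto simp: inj_on_def doubleton_eq_iff)
      show "(\<lambda>u. {u, v}) ` nbrs E v = {e \<in> E. v \<in> e}"
      proof (intro equalityI subsetI)
        fix e assume e: "e \<in> {e \<in> E. v \<in> e}"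
        then obtain x y where "e = {x, y}" using assms by (auto simp: sgraph_def)
        then have "\<exists>u. e = {u, v}" using e by auto
        then show "e \<in> (\<lambda>u. {u, v}) ` nbrs E v" using e by (auto simp: nbrs_def)
      qed (auto simp: nbrs_def)
    qed
  qed
  then have "(\<Sum>v\<in>V. card (nbrs E v)) = (\<Sum>v\<in>V. card {e \<in> E. v \<in> e})" by simp
  also have "\<dots> = (\<Sum>e\<in>E. card {v \<in> V. v \<in> e})"
    by (rule sum_card_flip) (use assms sgraph_finite_edges in \<open>auto simp: sgraph_def\<close>)
  also have "\<dots> = (\<Sum>e\<in>E. 2)"
  proof (rule sum.cong)
    fix e assume "e \<in> E"
    then obtain x y where xy: "x \<in> V" "y \<in> V" "x \<noteq> y" "e = {x, y}" using assms by (auto simp: sgraph_def)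
    then have "{v \<in> V. v \<in> e} = {x, y}" by auto
    then show "card {v \<in> V. v \<in> e} = 2" using xy by simp
  qed simp
  finally show ?thesis by simp
qed

text \<open>The last two conditions in \<open>deg3\<close> hold as soon as \<open>deg22\<close> is
  excluded; the labelling uses them to keep the second neighbours of \<open>u\<close> and
  \<open>w\<close> off the configuration.\<close>

lemma sparse_imp_reducible:
  assumes sg: "sgraph V E" and sparse: "3 * card E < 4 * card V"
  obtains (deg1) v where "v \<in> V" "card (nbrs E v) \<le> 1"
  | (deg22) u v where "u \<in> nbrs E v" "card (nbrs E u) = 2" "card (nbrs E v) = 2"
  | (deg3) v u w where "card (nbrs E v) = 3" "u \<in> nbrs E v" "w \<in> nbrs E v" "u \<noteq> w"
      "card (nbrs E u) = 2" "card (nbrs E w) = 2" "\<And>x. x \<in> nbrs E u \<Longrightarrow> card (nbrs E x) \<noteq> 2"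
      "\<And>x. x \<in> nbrs E w \<Longrightarrow> card (nbrs E x) \<noteq> 2"
proof (rule ccontr)
  assume none: "\<not> thesis"
  have fin: "finite V" using sg by (simp add: sgraph_def)
  define d where "d v = card (nbrs E v)" for v
  \<comment> \<open>\<open>t v / 3\<close> is the charge that \<open>v\<close> gives away to its
    neighbours of degree 2.\<close>
  define t where "t v = card {u \<in> nbrs E v. d u = 2}" for v
  have A: "2 \<le> d v" if "v \<in> V" for v using none deg1 that unfolding d_def by force
  have B: "d u \<noteq> 2" if "u \<in> nbrs E v" "d v = 2" for u v
    using none deg22 that unfolding d_def by metis
  have C: "t v \<le> 1" if "d v = 3" for v
  proof (rule ccontr)
    assume "\<not> t v \<le> 1"
    then obtain u w where uw: "u \<in> nbrs E v" "w \<in> nbrs E v" "d u = 2" "d w = 2" "u \<noteq> w"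
      using card_le_Suc0_iff_eq[of "{u \<in> nbrs E v. d u = 2}"] finite_nbrs[OF sg, of v]
      by (auto simp: t_def)
    then show False using none deg3[of v u w] that B uw nbrs_sym[of _ E] unfolding d_def by metis
  qed
  have t0: "t v = 0" if "d v = 2" for v
  proof -
    have "{u \<in> nbrs E v. d u = 2} = {}" using B[OF _ that] by blast
    then show ?thesis unfolding t_def by (simp only: card.empty)
  qed
  have t_le: "t v \<le> d v" for v
    unfolding t_def d_def by (rule card_mono) (auto simp: finite_nbrs[OF sg])
  \<comment> \<open>Double counting: each vertex of degree 2 is counted by exactly its two
    neighbours.\<close>
  have "(\<Sum>v\<in>V. t v) = (\<Sum>v\<in>V. card {u \<in> {u \<in> V. d u = 2}. u \<in> nbrs E v})"
    unfolding t_def using nbrs_subset[OF sg] by (intro sum.cong arg_cong[of _ _ card]) auto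
  also have "\<dots> = (\<Sum>u\<in>{u \<in> V. d u = 2}. card {v \<in> V. u \<in> nbrs E v})"
    by (rule sum_card_flip) (use fin in auto)
  also have "\<dots> = (\<Sum>u\<in>{u \<in> V. d u = 2}. 2)"
  proof (rule sum.cong)
    fix u assume "u \<in> {u \<in> V. d u = 2}"
    moreover have "{v \<in> V. u \<in> nbrs E v} = nbrs E u" using nbrs_subset[OF sg] nbrs_sym by fastforce
    ultimately show "card {v \<in> V. u \<in> nbrs E v} = 2" by (simp add: d_def)
  qed simp
  also have "\<dots> = (\<Sum>v\<in>V. if d v = 2 then 2 else 0)" using fin by (simp add: sum.If_cases Int_def)
  finally have tsum: "(\<Sum>v\<in>V. t v) = (\<Sum>v\<in>V. if d v = 2 then 2 else 0)" .
  \<comment> \<open>Three times the final charge is at least 8 at every vertex: \<open>6 + 2\<close>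
    for degree 2, at least \<open>9 - 1\<close> for degree 3, and at least \<open>3 * d - d\<close>
    for degree \<open>d \<ge> 4\<close>.\<close>
  have "(\<Sum>v\<in>V. 8 + t v) \<le> (\<Sum>v\<in>V. 3 * d v + (if d v = 2 then 2 else 0))"
  proof (rule sum_mono)
    fix v assume v: "v \<in> V"
    consider "d v = 2" | "d v = 3" | "4 \<le> d v" using A[OF v] by linarith
    then show "8 + t v \<le> 3 * d v + (if d v = 2 then 2 else 0)"
      by cases (use t0[of v] C[of v] t_le[of v] in auto)
  qed
  then have "8 * card V \<le> 3 * (\<Sum>v\<in>V. d v)"
    using tsum by (simp add: sum.distrib sum_distrib_left)
  then show False using sparse handshake[OF sg] by (simp add: d_def)
qed

section \<open>Labelling by removal of reducible configurations\<close>

lemma card_2_other: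
  assumes "card S = 2" "a \<in> S"
  obtains b where "b \<noteq> a" "S = {a, b}"
  using assms by (metis card_2_iff doubleton_eq_iff insertE singletonD)

lemma card_3_other:
  assumes "card S = 3" "a \<in> S" "b \<in> S" "a \<noteq> b"
  obtains c where "c \<noteq> a" "c \<noteq> b" "S = {a, b, c}"
proof -
  have "card (S - {a, b}) = 1" using assms by (subst card_Diff_subset) auto
  then obtain c where "S - {a, b} = {c}" by (auto simp: card_1_singleton_iff)
  then show ?thesis using assms by (intro that[of c]) auto
qed

text \<open>Sparsity is asked of every nonempty \<open>W\<close>, so that it survives the deletion
  of a configuration. Nonzero labels guarantee that the equations for the deleted vertices can be
  solved.\<close>

lemma sparse_imp_labelling:
  fixes p :: "'a set \<Rightarrow> bool"
  assumes "sgraph V E"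
    and "\<And>W. W \<subseteq> V \<Longrightarrow> W \<noteq> {} \<Longrightarrow> 3 * card {e \<in> E. e \<subseteq> W} < 4 * card W"
  shows "\<exists>x. (\<forall>v. x v \<noteq> zero3) \<and> (\<forall>u v. {u, v} \<in> E \<longrightarrow> dot (x u) (x v) = p {u, v})"
  using assms
proof (induction "card V" arbitrary: V E rule: less_induct)
  case less
  note sg = less.prems(1)
  have fin: "finite V" using sg by (simp add: sgraph_def)
  \<comment> \<open>\<open>R\<close> is the deleted configuration: the rest is labelled by
    induction, and the equations of the edges meeting \<open>R\<close> stay open.\<close>
  have IH: "\<exists>x. (\<forall>v. x v \<noteq> zero3) \<and>
      (\<forall>u v. {u, v} \<in> E \<longrightarrow> u \<notin> R \<longrightarrow> v \<notin> R \<longrightarrow> dot (x u) (x v) = p {u, v})"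
    if "R \<subseteq> V" "R \<noteq> {}" for R
  proof -
    define E' where "E' = {e \<in> E. e \<subseteq> V - R}"
    have "sgraph (V - R) E'"
      by (rule sgraph_subgraph[OF sg]) (auto simp: E'_def)
    moreover have "card (V - R) < card V"
      by (rule psubset_card_mono) (use fin that in auto)
    moreover have "3 * card {e \<in> E'. e \<subseteq> W} < 4 * card W" if "W \<subseteq> V - R" "W \<noteq> {}" for W
    proof -
      have "{e \<in> E'. e \<subseteq> W} = {e \<in> E. e \<subseteq> W}" using that(1) by (auto simp: E'_def)
      then show ?thesis using less.prems(2)[of W] that by auto
    qed
    ultimately obtain x where x: "\<forall>v. x v \<noteq> zero3" "\<forall>u v. {u, v} \<in> E' \<longrightarrow> dot (x u) (x v) = p {u, v}"
      using less.hyps[of "V - R" E'] by blast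
    show ?thesis
    proof (intro exI[of _ x] conjI allI impI)
      fix u v assume "{u, v} \<in> E" "u \<notin> R" "v \<notin> R"
      then have "{u, v} \<in> E'" using sgraph_edge_subset[OF sg, of "{u, v}"] by (auto simp: E'_def)
      then show "dot (x u) (x v) = p {u, v}" using x(2) by blast
    qed (use x(1) in blast)
  qed
  \<comment> \<open>Relabelling within \<open>R\<close> leaves the other equations untouched, so
    only edges that meet \<open>R\<close> are checked.\<close>
  have ext: ?case
    if R: "finite R" and x: "\<forall>v. x v \<noteq> zero3" and y: "\<forall>v. y v \<noteq> zero3" and out: "\<forall>v. v \<notin> R \<longrightarrow> y v = x v"
      and xE: "\<forall>u v. {u, v} \<in> E \<longrightarrow> u \<notin> R \<longrightarrow> v \<notin> R \<longrightarrow> dot (x u) (x v) = p {u, v}"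
      and yE: "\<forall>u\<in>R. \<forall>v\<in>nbrs E u. dot (y u) (y v) = p {u, v}" for R x y
  proof (intro exI[of _ y] conjI allI impI)
    show "y v \<noteq> zero3" for v using y by blast
    fix u v assume uv: "{u, v} \<in> E"
    show "dot (y u) (y v) = p {u, v}"
    proof (cases "u \<in> R \<or> v \<in> R")
      case True
      then show ?thesis using yE uv dot_commute by (metis in_nbrs_iff insert_commute)
    next
      case False
      then show ?thesis using xE out uv by metis
    qed
  qed
  show ?case
  proof (cases "V = {}")
    case True
    then have "E = {}" using sg by (auto simp: sgraph_def)
    then show ?thesis by (intro exI[of _ "\<lambda>_. (True, False, False)"]) auto
  next
    case False
    have "{e \<in> E. e \<subseteq> V} = E" using sgraph_edge_subset[OF sg] by auto
    then have sparse: "3 * card E < 4 * card V" using less.prems(2)[of V] False by simp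
    from sg sparse show ?thesis
    proof (cases rule: sparse_imp_reducible)
      case (deg1 v)
      obtain x where x: "\<forall>v. x v \<noteq> zero3"
        and xE: "\<forall>a b. {a, b} \<in> E \<longrightarrow> a \<notin> {v} \<longrightarrow> b \<notin> {v} \<longrightarrow> dot (x a) (x b) = p {a, b}"
        using IH[of "{v}"] deg1(1) by auto
      have "\<forall>a\<in>nbrs E v. \<forall>b\<in>nbrs E v. a = b"
        using deg1(2) finite_nbrs[OF sg, of v] by (simp add: card_le_Suc0_iff_eq)
      \<comment> \<open>If \<open>v\<close> has no neighbour, \<open>a\<close> is arbitrary and its
        equation does no harm.\<close>
      then have "\<exists>a. nbrs E v \<subseteq> {a}" by blast
      then obtain a where a: "nbrs E v \<subseteq> {a} - {v}"
        using nbrs_subset[OF sg, of v] by blast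
      \<comment> \<open>Only the zero vector has to be avoided here, hence \<open>zero3\<close> in
        both places.\<close>
      obtain z where z: "z \<noteq> zero3" "dot z (x a) = p {v, a}"
        using dot_solve_avoiding[of "x a" zero3 zero3 "p {v, a}"] x by blast
      show ?thesis
        by (rule ext[of "{v}" x "x(v := z)"]) (use x xE z a in auto)
    next
      case (deg22 u v)
      obtain a where a: "a \<noteq> v" "nbrs E u = {v, a}"
        using card_2_other[OF deg22(2), of v] deg22(1) nbrs_sym[of u E v] by metis
      obtain b where b: "b \<noteq> u" "nbrs E v = {u, b}"
        using card_2_other[OF deg22(3,1)] by metis
      have *: "u \<in> V" "v \<in> V" "u \<noteq> v" "a \<noteq> u" "b \<noteq> v"
        using nbrs_subset[OF sg, of u] nbrs_subset[OF sg, of v] a b by auto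
      obtain x where x: "\<forall>v. x v \<noteq> zero3"
        and xE: "\<forall>s t. {s, t} \<in> E \<longrightarrow> s \<notin> {u, v} \<longrightarrow> t \<notin> {u, v} \<longrightarrow> dot (x s) (x t) = p {s, t}"
        using IH[of "{u, v}"] * by auto
      \<comment> \<open>Avoiding \<open>x b\<close> makes \<open>y\<close> and \<open>x b\<close>
        independent, so that the two equations at \<open>v\<close> have a solution
        \<open>z\<close>.\<close>
      obtain y where y: "y \<noteq> zero3" "y \<noteq> x b" "dot y (x a) = p {u, a}"
        using dot_solve_avoiding[of "x a" "x b" "x b" "p {u, a}"] x by blast
      obtain z where z: "z \<noteq> zero3" "dot z y = p {v, u}" "dot z (x b) = p {v, b}"
        using dot_solve_two[of y "x b" "p {v, u}" "p {v, b}"] x y by metis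
      show ?thesis
        by (rule ext[of "{u, v}" x "x(u := y, v := z)"])
          (use x xE y z a b * in \<open>auto simp: dot_commute[of y z] insert_commute\<close>)
    next
      case (deg3 v u w)
      obtain c where c: "c \<noteq> u" "c \<noteq> w" "nbrs E v = {u, w, c}"
        using card_3_other[OF deg3(1-4)] by metis
      obtain a where a: "a \<noteq> v" "nbrs E u = {v, a}"
        using card_2_other[OF deg3(5), of v] deg3(2) nbrs_sym[of u E v] by metis
      obtain b where b: "b \<noteq> v" "nbrs E w = {v, b}"
        using card_2_other[OF deg3(6), of v] deg3(3) nbrs_sym[of w E v] by metis
      have *: "u \<in> V" "w \<in> V" "v \<in> V" "u \<noteq> v" "w \<noteq> v" "c \<noteq> v" "a \<noteq> u" "b \<noteq> w"
        using nbrs_subset[OF sg, of u] nbrs_subset[OF sg, of v] nbrs_subset[OF sg, of w] a b c by auto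
      \<comment> \<open>\<open>u\<close> and \<open>w\<close> have degree 2 but their neighbours do
        not, so \<open>a\<close> and \<open>b\<close> lie outside \<open>{u, v, w}\<close> and keep
        their labels.\<close>
      have "a \<in> nbrs E u" "b \<in> nbrs E w" by (simp_all add: a b)
      then have "card (nbrs E a) \<noteq> 2" "card (nbrs E b) \<noteq> 2" using deg3(7,8) by metis+
      then have **: "a \<noteq> w" "b \<noteq> u" using deg3(5,6) by metis+
      obtain x where x: "\<forall>v. x v \<noteq> zero3"
        and xE: "\<forall>s t. {s, t} \<in> E \<longrightarrow> s \<notin> {u, v, w} \<longrightarrow> t \<notin> {u, v, w} \<longrightarrow> dot (x s) (x t) = p {s, t}"
        using IH[of "{u, v, w}"] * by auto
      \<comment> \<open>Of the four solutions for the edge to \<open>c\<close>, at most three are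
        lost to \<open>zero3\<close>, \<open>x a\<close> and \<open>x b\<close>. Then
        \<open>u\<close> and \<open>w\<close> each face two independent equations.\<close>
      obtain y where y: "y \<noteq> zero3" "y \<noteq> x a" "y \<noteq> x b" "dot y (x c) = p {v, c}"
        using dot_solve_avoiding[of "x c" "x a" "x b" "p {v, c}"] x by blast
      obtain r where r: "r \<noteq> zero3" "dot r y = p {u, v}" "dot r (x a) = p {u, a}"
        using dot_solve_two[of y "x a" "p {u, v}" "p {u, a}"] x y by metis
      obtain s where s: "s \<noteq> zero3" "dot s y = p {w, v}" "dot s (x b) = p {w, b}"
        using dot_solve_two[of y "x b" "p {w, v}" "p {w, b}"] x y by metis
      show ?thesis
        by (rule ext[of "{u, v, w}" x "x(v := y, u := r, w := s)"])
          (use x xE y r s a b c * ** deg3(4) in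
            \<open>auto simp: dot_commute[of y r] dot_commute[of y s] insert_commute\<close>)
    qed
  qed
qed

section \<open>Drawings and Jordan curves\<close>

definition img :: "('a set \<Rightarrow> real \<Rightarrow> complex) \<Rightarrow> 'a set set \<Rightarrow> complex set" where
  "img g F = (\<Union>e\<in>F. path_image (g e))"

lemma img_Un: "img g (F \<union> F') = img g F \<union> img g F'"
  by (auto simp: img_def)

abbreviation closed_inside :: "complex set \<Rightarrow> complex set" where
  "closed_inside X \<equiv> X \<union> inside X"

lemma closure_inside_Jordan:
  assumes "simple_path c" "pathfinish c = pathstart c"
  shows "closure (inside (path_image c)) = closed_inside (path_image c)"
  using Jordan_inside_outside[OF assms] closure_Un_frontier[of "inside (path_image c)"] by blast

text \<open>The ends are limits of interior points, as [0, 1] is the closure of the open interval.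
  This lets the position of an edge be read off from its open part.\<close>

lemma arc_subset_closure:
  assumes "arc c"
  shows "path_image c \<subseteq> closure (path_image c - {pathstart c, pathfinish c})"
proof -
  have "continuous_on {0..1} c" using assms by (simp add: arc_def path_def)
  then have "c ` closure {0<..<1} \<subseteq> closure (c ` {0<..<1})"
    by (rule continuous_image_closure_subset) simp
  then show ?thesis
    using simple_path_endless[OF arc_imp_simple_path[OF assms]] by (simp add: path_image_def)
qed

text \<open>The conditions of \<open>plane_drawing\<close>, but over undirected edges and arbitrary
  \<open>V\<close> and \<open>E\<close>, so that they pass to subgraphs and to images under
  injective continuous maps.\<close>

locale drawing =
  fixes p :: "'a \<Rightarrow> complex" and g :: "'a set \<Rightarrow> real \<Rightarrow> complex"
    and V :: "'a set" and E :: "'a set set"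
  assumes sgraph: "sgraph V E"
    and inj: "inj_on p V"
    and arc_edge: "e \<in> E \<Longrightarrow> arc (g e)"
    and edge_ends: "e \<in> E \<Longrightarrow> {pathstart (g e), pathfinish (g e)} = p ` e"
    and edge_vertices: "e \<in> E \<Longrightarrow> path_image (g e) \<inter> p ` V = p ` e"
    and edge_edge: "e \<in> E \<Longrightarrow> f \<in> E \<Longrightarrow> e \<noteq> f \<Longrightarrow> path_image (g e) \<inter> path_image (g f) \<subseteq> p ` (e \<inter> f)"
begin

lemma edge_subset: "e \<in> E \<Longrightarrow> e \<subseteq> V"
  by (rule sgraph_edge_subset[OF sgraph])

lemma subgraph:
  assumes "V' \<subseteq> V" "E' \<subseteq> E" "\<And>e. e \<in> E' \<Longrightarrow> e \<subseteq> V'"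
  shows "drawing p g V' E'"
proof
  show "sgraph V' E'" by (rule sgraph_subgraph[OF sgraph assms])
  show "inj_on p V'" using inj assms(1) by (rule inj_on_subset)
  fix e assume e: "e \<in> E'"
  then have eE: "e \<in> E" using assms(2) by blast
  show "arc (g e)" "{pathstart (g e), pathfinish (g e)} = p ` e"
    using arc_edge[OF eE] edge_ends[OF eE] by auto
  show "path_image (g e) \<inter> p ` V' = p ` e"
    using edge_vertices[OF eE] assms(1) assms(3)[OF e] by blast
  fix f assume "f \<in> E'" "e \<noteq> f"
  then show "path_image (g e) \<inter> path_image (g f) \<subseteq> p ` (e \<inter> f)"
    using edge_edge[OF eE] assms(2) by blast
qed

lemma img_Int:
  assumes "F \<subseteq> E" "F' \<subseteq> E" "F \<inter> F' = {}"
  shows "img g F \<inter> img g F' \<subseteq> p ` (\<Union>F \<inter> \<Union>F')"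
proof
  fix z assume "z \<in> img g F \<inter> img g F'"
  then obtain e f where ef: "e \<in> F" "f \<in> F'" "z \<in> path_image (g e) \<inter> path_image (g f)"
    by (auto simp: img_def)
  then have "z \<in> p ` (e \<inter> f)" using edge_edge[of e f] assms by blast
  then show "z \<in> p ` (\<Union>F \<inter> \<Union>F')" using ef by blast
qed

lemma vertex_in_img:
  assumes "v \<in> V" "F \<subseteq> E"
  shows "p v \<in> img g F \<longleftrightarrow> v \<in> \<Union>F"
proof
  assume "p v \<in> img g F"
  then obtain e where e: "e \<in> F" "p v \<in> path_image (g e)" by (auto simp: img_def)
  then have "p v \<in> p ` e" using edge_vertices[of e] assms by blast
  then show "v \<in> \<Union>F"
    using e assms inj edge_subset[of e] by (metis UnionI inj_on_image_mem_iff subsetD)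
next
  assume "v \<in> \<Union>F"
  then obtain e where "e \<in> F" "v \<in> e" by blast
  then show "p v \<in> img g F" using edge_vertices[of e] assms by (auto simp: img_def)
qed

lemma edge_not_subset_finite:
  assumes "e \<in> E" "finite S"
  shows "\<not> path_image (g e) \<subseteq> S"
  using arc_image_uncountable[OF arc_edge[OF assms(1)]] assms(2)
  by (meson countable_finite finite_subset)

lemma finite_edge: "e \<in> E \<Longrightarrow> finite e"
  using sgraph_edgeE[OF sgraph] by (metis finite.simps)

text \<open>An edge not in \<open>F\<close> meets the drawing of \<open>F\<close> at most in its two
  ends, while an arc is uncountable.\<close>

lemma edge_in_img:
  assumes "e \<in> E" "F \<subseteq> E" "path_image (g e) \<subseteq> img g F"
  shows "e \<in> F"
proof (rule ccontr)
  assume "e \<notin> F"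
  then have "img g {e} \<inter> img g F \<subseteq> p ` (\<Union>{e} \<inter> \<Union>F)" using assms by (intro img_Int) auto
  then have "path_image (g e) \<subseteq> p ` e" using assms(3) by (auto simp: img_def)
  then show False using edge_not_subset_finite[OF assms(1)] finite_edge[OF assms(1)] by blast
qed

lemma edge_interior_disjoint:
  assumes "e \<in> E" "F \<subseteq> E" "e \<notin> F"
  shows "(path_image (g e) - p ` e) \<inter> img g F = {}"
proof -
  have "img g {e} \<inter> img g F \<subseteq> p ` (\<Union>{e} \<inter> \<Union>F)" using assms by (intro img_Int) auto
  then show ?thesis by (auto simp: img_def)
qed

text \<open>The open edge is connected and hence contained in one of the two open sets; the closure
  adds its ends.\<close>

lemma edge_one_side:
  assumes "e \<in> E" "open S" "open T" "S \<inter> T = {}" "path_image (g e) - p ` e \<subseteq> S \<union> T"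
  shows "path_image (g e) \<subseteq> closure S \<or> path_image (g e) \<subseteq> closure T"
proof -
  let ?I = "path_image (g e) - p ` e"
  have "Topological_Spaces.connected ?I"
    using connected_simple_path_endless[OF arc_imp_simple_path[OF arc_edge[OF assms(1)]]]
    by (simp add: edge_ends[OF assms(1)])
  then have "S \<inter> ?I = {} \<or> T \<inter> ?I = {}"
    by (rule connectedD[OF _ assms(2,3)]) (use assms(4,5) in auto)
  then have "?I \<subseteq> S \<or> ?I \<subseteq> T" using assms(5) by blast
  moreover have "path_image (g e) \<subseteq> closure ?I"
    using arc_subset_closure[OF arc_edge[OF assms(1)]] by (simp add: edge_ends[OF assms(1)])
  ultimately show ?thesis by (meson closure_mono order_trans)
qed

section \<open>Paths and cycles as arcs and Jordan curves\<close>

lemma path_arc: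
  assumes "distinct vs" "2 \<le> length vs" "path_edges vs \<subseteq> E"
  obtains c where "arc c" "pathstart c = p (hd vs)" "pathfinish c = p (last vs)"
    "path_image c = img g (path_edges vs)"
proof -
  have "\<exists>c. arc c \<and> pathstart c = p (hd vs) \<and> pathfinish c = p (last vs) \<and>
      path_image c = img g (path_edges vs)"
    using assms
  proof (induction vs rule: path_edges.induct)
    case (1 u v vs)
    let ?e = "{u, v}"
    have e: "?e \<in> E" using 1 by simp
    \<comment> \<open>\<open>g\<close> is indexed by the unordered edge, so its arc may run from
      \<open>v\<close> to \<open>u\<close> and then has to be reversed.\<close>
    have "\<exists>c. arc c \<and> pathstart c = p u \<and> pathfinish c = p v \<and> path_image c = path_image (g ?e)"
    proof (cases "pathstart (g ?e) = p u")
      case True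
      then have "pathfinish (g ?e) = p v"
        using edge_ends[OF e] arc_distinct_ends[OF arc_edge[OF e]] by (auto simp: doubleton_eq_iff)
      then show ?thesis using True arc_edge[OF e] by blast
    next
      case False
      then have "pathstart (g ?e) = p v" "pathfinish (g ?e) = p u"
        using edge_ends[OF e] by (auto simp: doubleton_eq_iff)
      then show ?thesis
        using arc_edge[OF e] by (intro exI[of _ "reversepath (g ?e)"]) (simp add: arc_reversepath)
    qed
    then obtain c where c: "arc c" "pathstart c = p u" "pathfinish c = p v"
      "path_image c = path_image (g ?e)" by blast
    show ?case
    proof (cases "vs = []")
      case True
      then show ?thesis using c by (auto simp: img_def)
    next
      case False
      then have "2 \<le> length (v # vs)" by (cases vs) auto
      then obtain d where d: "arc d" "pathstart d = p v" "pathfinish d = p (last (v # vs))"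
        "path_image d = img g (path_edges (v # vs))" using 1 by auto
      have ne: "?e \<notin> path_edges (v # vs)" using path_edge_subset 1(2) by fastforce
      have "img g {?e} \<inter> img g (path_edges (v # vs)) \<subseteq> p ` (\<Union>{?e} \<inter> \<Union>(path_edges (v # vs)))"
        using ne 1(4) by (intro img_Int) auto
      also have "\<Union>(path_edges (v # vs)) = set (v # vs)"
        by (rule Union_path_edges) fact
      also have "\<Union>{?e} \<inter> set (v # vs) = {v}" using 1(2) by auto
      finally have "path_image c \<inter> path_image d \<subseteq> {pathstart d}"
        using c d by (simp add: img_def)
      then have "arc (c +++ d)" using c d by (intro arc_join) auto
      moreover have "path_image (c +++ d) = img g (path_edges (u # v # vs))"
        using c d by (simp add: path_image_join img_def)
      ultimately show ?thesis using c d False by (intro exI[of _ "c +++ d"]) auto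
    qed
  qed auto
  then show ?thesis using that by blast
qed

text \<open>\<open>cycle_splitE\<close> cuts the cycle into two paths, whose arcs meet only in
  \<open>p a\<close> and \<open>p b\<close> and therefore join to a simple loop.\<close>

lemma cycle_Jordan:
  assumes "cycle_in E C"
  obtains c where "simple_path c" "pathfinish c = pathstart c" "path_image c = img g (cycle_edges C)"
proof -
  obtain a b D where C: "C = a # b # D"
    using assms by (cases C rule: path_edges.cases) (auto simp: cycle_in_def)
  have "a \<in> set C" "b \<in> set C" "a \<noteq> b" using assms C by (auto simp: cycle_in_def)
  from cycle_splitE[OF assms this] obtain xs ys where
    *: "distinct (a # b # xs @ ys)" "xs \<noteq> [] \<or> ys \<noteq> []"
      "cycle_edges C = path_edges (a # xs @ [b]) \<union> path_edges (a # ys @ [b])" .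
  have sub: "path_edges (a # xs @ [b]) \<subseteq> E" "path_edges (a # ys @ [b]) \<subseteq> E"
    using assms *(3) by (auto simp: cycle_in_def)
  obtain c where c: "arc c" "pathstart c = p a" "pathfinish c = p b"
    "path_image c = img g (path_edges (a # xs @ [b]))"
    by (rule path_arc[OF _ _ sub(1)]) (use *(1) in auto)
  obtain d where d: "arc d" "pathstart d = p a" "pathfinish d = p b"
    "path_image d = img g (path_edges (a # ys @ [b]))"
    by (rule path_arc[OF _ _ sub(2)]) (use *(1) in auto)
  have "path_image c \<inter> path_image d \<subseteq> p ` (set (a # xs @ [b]) \<inter> set (a # ys @ [b]))"
    using img_Int[OF sub path_edges_disjoint[OF *(1,2)]] c d
    by (subst (asm) (1 2) Union_path_edges) auto
  also have "set (a # xs @ [b]) \<inter> set (a # ys @ [b]) = {a, b}" using *(1) by auto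
  finally have "simple_path (c +++ reversepath d)"
    using c d by (intro simple_path_join_loop) (auto simp: arc_reversepath)
  then show ?thesis
    using c d *(3) by (intro that[of "c +++ reversepath d"]) (auto simp: path_image_join img_Un)
qed

lemma cycle_inside_open:
  assumes "cycle_in E C"
  shows "open (inside (img g (cycle_edges C)))"
  using cycle_Jordan[OF assms] Jordan_inside_outside by metis

lemma closure_inside_cycle:
  assumes "cycle_in E C"
  shows "closure (inside (img g (cycle_edges C))) = closed_inside (img g (cycle_edges C))"
  using cycle_Jordan[OF assms] closure_inside_Jordan by metis

text \<open>\<open>A1\<close>, \<open>A2\<close> and \<open>P\<close> form a theta graph with
  \<open>P\<close> in the middle. The theorem \<open>split_inside_simple_closed_curve\<close>
  applies once the three arcs are known to meet only in their ends.\<close>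

lemma theta_split:
  assumes d: "distinct (a # b # xs @ ys @ zs)"
    and A1: "A1 = path_edges (a # xs @ [b])" and A2: "A2 = path_edges (a # ys @ [b])"
    and P: "P = path_edges (a # zs @ [b])"
    and sub: "A1 \<subseteq> E" "A2 \<subseteq> E" "P \<subseteq> E"
    and disj: "A1 \<inter> A2 = {}" "A1 \<inter> P = {}" "A2 \<inter> P = {}"
    and inside: "img g P \<subseteq> closed_inside (img g (A1 \<union> A2))"
  shows "inside (img g (A1 \<union> P)) \<inter> inside (img g (A2 \<union> P)) = {}"
    and "inside (img g (A1 \<union> P)) \<union> inside (img g (A2 \<union> P)) \<union> (img g P - {p a, p b}) =
      inside (img g (A1 \<union> A2))"
proof -
  obtain c1 where c1: "arc c1" "pathstart c1 = p a" "pathfinish c1 = p b" "path_image c1 = img g A1"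
    unfolding A1 by (rule path_arc[OF _ _ sub(1)[unfolded A1]]) (use d in auto)
  obtain c2 where c2: "arc c2" "pathstart c2 = p a" "pathfinish c2 = p b" "path_image c2 = img g A2"
    unfolding A2 by (rule path_arc[OF _ _ sub(2)[unfolded A2]]) (use d in auto)
  obtain c where c: "arc c" "pathstart c = p a" "pathfinish c = p b" "path_image c = img g P"
    unfolding P by (rule path_arc[OF _ _ sub(3)[unfolded P]]) (use d in auto)
  have U: "\<Union>A1 = set (a # xs @ [b])" "\<Union>A2 = set (a # ys @ [b])" "\<Union>P = set (a # zs @ [b])"
    unfolding A1 A2 P by (rule Union_path_edges; simp)+
  have ends: "{p a, p b} \<subseteq> path_image q" if "pathstart q = p a" "pathfinish q = p b" for q
    using that by (metis empty_subsetI insert_subset pathfinish_in_path_image pathstart_in_path_image)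
  have V12: "\<Union>A1 \<inter> \<Union>A2 = {a, b}" "\<Union>A1 \<inter> \<Union>P = {a, b}" "\<Union>A2 \<inter> \<Union>P = {a, b}"
    unfolding U using d by auto
  have I: "path_image c1 \<inter> path_image c2 = {p a, p b}" "path_image c1 \<inter> path_image c = {p a, p b}"
    "path_image c2 \<inter> path_image c = {p a, p b}"
    using img_Int[OF sub(1,2) disj(1)] img_Int[OF sub(1,3) disj(2)] img_Int[OF sub(2,3) disj(3)]
      ends[OF c1(2,3)] ends[OF c2(2,3)] ends[OF c(2,3)]
    unfolding V12 c1(4) c2(4) c(4) by auto
  have "p a \<noteq> p b" using c arc_distinct_ends by metis
  \<comment> \<open>The middle arc does enter the inside: otherwise it would lie on the cycle, hence
    in the two points \<open>p a\<close> and \<open>p b\<close>.\<close>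
  have ne: "path_image c \<inter> inside (path_image c1 \<union> path_image c2) \<noteq> {}"
  proof
    assume "path_image c \<inter> inside (path_image c1 \<union> path_image c2) = {}"
    then have "path_image c \<subseteq> path_image c1 \<union> path_image c2"
      using inside unfolding img_Un c1(4) c2(4) c(4) by blast
    then have "path_image c \<subseteq> {p a, p b}" using I by blast
    then have "finite (path_image c)" by (rule finite_subset) simp
    then show False using arc_image_uncountable[OF c(1)] countable_finite by blast
  qed
  have "inside (path_image c1 \<union> path_image c) \<inter> inside (path_image c2 \<union> path_image c) = {} \<and>
    inside (path_image c1 \<union> path_image c) \<union> inside (path_image c2 \<union> path_image c) \<union>
      (path_image c - {p a, p b}) = inside (path_image c1 \<union> path_image c2)"
    by (rule split_inside_simple_closed_curve[OF arc_imp_simple_path[OF c1(1)] c1(2,3)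
        arc_imp_simple_path[OF c2(1)] c2(2,3) arc_imp_simple_path[OF c(1)] c(2,3) \<open>p a \<noteq> p b\<close> I ne])
      (rule conjI)
  then show "inside (img g (A1 \<union> P)) \<inter> inside (img g (A2 \<union> P)) = {}"
    "inside (img g (A1 \<union> P)) \<union> inside (img g (A2 \<union> P)) \<union> (img g P - {p a, p b}) =
      inside (img g (A1 \<union> A2))"
    unfolding img_Un c1(4) c2(4) c(4) by (rule conjunct1, rule conjunct2)
qed

end

section \<open>The number of edges of a plane graph\<close>

text \<open>The components of the vertices of \<open>C\<close> are disjoint and each yields a
  surplus \<open>k\<close>, together \<open>k * length C\<close>. The cycle edges use up
  \<open>(k - 2) * length C\<close> of it, and the remaining \<open>2 * length C\<close> is at least
  \<open>k + length C\<close>.\<close>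

lemma card_edges_no_ear:
  assumes sg: "sgraph V E" and C: "cycle_in E C" and k: "2 \<le> k" "k \<le> length C"
    and no_ear: "\<And>a b. a \<in> set C \<Longrightarrow> b \<in> set C \<Longrightarrow>
      (a, b) \<in> {(x, y). {x, y} \<in> E - cycle_edges C}\<^sup>* \<Longrightarrow> a = b"
    and bound: "\<And>V' E'. V' \<subseteq> V \<Longrightarrow> E' \<subset> E \<Longrightarrow> V' \<noteq> {} \<Longrightarrow> (\<And>e. e \<in> E' \<Longrightarrow> e \<subseteq> V') \<Longrightarrow>
      (k - 2) * card E' + k \<le> k * card V'"
  shows "(k - 2) * card E + k + length C \<le> k * card V"
proof -
  have fin: "finite V" "finite E" using sg sgraph_finite_edges[OF sg] by (auto simp: sgraph_def)
  define R where "R = {(x, y). {x, y} \<in> E - cycle_edges C}\<^sup>*"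
  have "sym R" unfolding R_def by (intro sym_rtrancl) (auto simp: sym_def insert_commute)
  have "trans R" unfolding R_def by (rule trans_rtrancl)
  have CE: "cycle_edges C \<subseteq> E" using C by (simp add: cycle_in_def)
  have dC: "distinct C" using C by (simp add: cycle_in_def)
  have CV: "set C \<subseteq> V"
    using Union_cycle_edges[OF C] CE sgraph_edge_subset[OF sg] by blast
  have cE: "card (cycle_edges C) = length C" by (rule card_cycle_edges[OF C])
  have "length C \<noteq> 0" using C by (auto simp: cycle_in_def)
  then have ne: "cycle_edges C \<noteq> {}" using cE by auto
  \<comment> \<open>\<open>K c\<close> is the component of \<open>c\<close>; \<open>W\<close>
    collects all components without a vertex of \<open>C\<close>, and the bound is applied to
    \<open>W\<close> as a whole.\<close>
  define K where "K c = {v \<in> V. (c, v) \<in> R}" for c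
  define W where "W = V - (\<Union>c\<in>set C. K c)"
  define EK where "EK U = {e \<in> E - cycle_edges C. e \<subseteq> U}" for U
  have disj: "K c \<inter> K d = {}" if "c \<in> set C" "d \<in> set C" "c \<noteq> d" for c d
  proof (rule ccontr)
    assume "K c \<inter> K d \<noteq> {}"
    then obtain v where "(c, v) \<in> R" "(d, v) \<in> R" by (auto simp: K_def)
    then have "(c, d) \<in> R" using \<open>sym R\<close> \<open>trans R\<close> by (meson symD transD)
    then show False using no_ear that by (simp add: R_def)
  qed
  \<comment> \<open>The cycle edges are missing from \<open>EK U\<close>, which supplies the strict
    inclusion demanded by \<open>bound\<close>.\<close>
  have EK_sub: "EK U \<subset> E" for U using ne CE by (auto simp: EK_def)
  have "E - cycle_edges C \<subseteq> (\<Union>c\<in>set C. EK (K c)) \<union> EK W"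
  proof
    fix e assume e: "e \<in> E - cycle_edges C"
    then obtain x y where xy: "x \<in> V" "y \<in> V" "e = {x, y}"
      using sgraph_edgeE[OF sg, of e] by (metis DiffD1)
    have step: "(x, y) \<in> R" "(y, x) \<in> R"
      using e xy(3) by (auto simp: R_def insert_commute)
    show "e \<in> (\<Union>c\<in>set C. EK (K c)) \<union> EK W"
    proof (cases "\<exists>c\<in>set C. (c, x) \<in> R")
      case True
      then obtain c where c: "c \<in> set C" "(c, x) \<in> R" by blast
      then have "(c, y) \<in> R" using step \<open>trans R\<close> by (meson transD)
      then have "e \<in> EK (K c)" using c e xy by (auto simp: EK_def K_def)
      then show ?thesis using c by blast
    next
      case False
      then have "\<not> (\<exists>c\<in>set C. (c, y) \<in> R)" using step \<open>trans R\<close> by (meson transD)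
      with False have "e \<in> EK W" using e xy by (auto simp: EK_def W_def K_def)
      then show ?thesis by blast
    qed
  qed
  then have "card (E - cycle_edges C) \<le> card ((\<Union>c\<in>set C. EK (K c)) \<union> EK W)"
    using fin by (intro card_mono) (auto simp: EK_def)
  also have "\<dots> \<le> card (\<Union>c\<in>set C. EK (K c)) + card (EK W)" by (rule card_Un_le)
  also have "\<dots> \<le> (\<Sum>c\<in>set C. card (EK (K c))) + card (EK W)"
    by (intro add_right_mono card_UN_le) simp
  finally have cards: "card E \<le> length C + ((\<Sum>c\<in>set C. card (EK (K c))) + card (EK W))"
    using CE cE fin by (simp add: card_Diff_subset finite_subset)
  have cardV: "card V = (\<Sum>c\<in>set C. card (K c)) + card W"
  proof -
    have "card V = card (\<Union>c\<in>set C. K c) + card W"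
      using fin unfolding W_def
      by (subst card_Un_disjoint[symmetric]) (auto simp: K_def intro!: arg_cong[of _ _ card])
    also have "card (\<Union>c\<in>set C. K c) = (\<Sum>c\<in>set C. card (K c))"
      by (rule card_UN_disjoint) (use fin disj in \<open>auto simp: K_def\<close>)
    finally show ?thesis .
  qed
  have "(\<Sum>c\<in>set C. (k - 2) * card (EK (K c)) + k) \<le> (\<Sum>c\<in>set C. k * card (K c))"
  proof (rule sum_mono)
    fix c assume "c \<in> set C"
    then have "c \<in> K c" using CV by (auto simp: K_def R_def)
    then show "(k - 2) * card (EK (K c)) + k \<le> k * card (K c)"
      by (intro bound EK_sub) (auto simp: K_def EK_def)
  qed
  then have s1: "(k - 2) * (\<Sum>c\<in>set C. card (EK (K c))) + k * length C \<le> k * (\<Sum>c\<in>set C. card (K c))"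
    using distinct_card[OF dC] by (simp add: sum.distrib sum_distrib_left mult.commute)
  \<comment> \<open>\<open>W\<close> may be empty, so its surplus \<open>k\<close> is given
    up.\<close>
  have s2: "(k - 2) * card (EK W) \<le> k * card W"
  proof (cases "W = {}")
    case True
    have "e \<noteq> {}" if "e \<in> E" for e using sgraph_edgeE[OF sg that] by blast
    then have "EK W = {}" using True by (auto simp: EK_def)
    then show ?thesis by simp
  next
    case False
    then have "(k - 2) * card (EK W) + k \<le> k * card W"
      by (intro bound EK_sub) (auto simp: W_def EK_def)
    then show ?thesis by simp
  qed
  \<comment> \<open>Writing \<open>k = m + 2\<close> removes the truncated subtraction.\<close>
  obtain m where m: "k = m + 2" using k(1) by (metis add.commute le_Suc_ex)
  have "m * card E \<le> m * (length C + ((\<Sum>c\<in>set C. card (EK (K c))) + card (EK W)))"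
    using cards by (rule mult_le_mono2)
  then show ?thesis using s1 s2 k(2) unfolding cardV m by (simp add: algebra_simps)
qed

text \<open>\<open>n\<close> is the number of edges of the ear. The two parts share precisely the
  ear, with \<open>n\<close> edges and \<open>n + 1\<close> vertices; with these counts the disc
  bounds for the parts add up to the disc bound for the whole.\<close>

lemma (in drawing) ear_split:
  assumes C: "cycle_in E C"
    and Ein: "\<And>e. e \<in> E \<Longrightarrow> path_image (g e) \<subseteq> closed_inside (img g (cycle_edges C))"
    and Vin: "\<And>v. v \<in> V \<Longrightarrow> p v \<in> closed_inside (img g (cycle_edges C))"
    and ear: "a \<in> set C" "b \<in> set C" "distinct (a # zs @ [b])" "set zs \<inter> set C = {}"
      "path_edges (a # zs @ [b]) \<subseteq> E - cycle_edges C"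
  obtains V1 E1 C1 V2 E2 C2 n where
    "drawing p g V1 E1" "cycle_in E1 C1" "E1 \<subset> E"
    "\<And>e. e \<in> E1 \<Longrightarrow> path_image (g e) \<subseteq> closed_inside (img g (cycle_edges C1))"
    "\<And>v. v \<in> V1 \<Longrightarrow> p v \<in> closed_inside (img g (cycle_edges C1))"
    "drawing p g V2 E2" "cycle_in E2 C2" "E2 \<subset> E"
    "\<And>e. e \<in> E2 \<Longrightarrow> path_image (g e) \<subseteq> closed_inside (img g (cycle_edges C2))"
    "\<And>v. v \<in> V2 \<Longrightarrow> p v \<in> closed_inside (img g (cycle_edges C2))"
    "card E1 + card E2 = card E + n" "card V1 + card V2 = card V + n + 1"
    "length C1 + length C2 = length C + 2 * n"
proof -
  have fin: "finite V" "finite E" using sgraph sgraph_finite_edges[OF sgraph] by (auto simp: sgraph_def)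
  have "a \<noteq> b" using ear(3) by auto
  from cycle_splitE[OF C ear(1,2) this] obtain xs ys where
    xy: "distinct (a # b # xs @ ys)" "xs \<noteq> [] \<or> ys \<noteq> []" "set C = {a, b} \<union> set xs \<union> set ys"
      "length C = length xs + length ys + 2"
      "cycle_edges C = path_edges (a # xs @ [b]) \<union> path_edges (a # ys @ [b])" .
  define A1 where "A1 = path_edges (a # xs @ [b])"
  define A2 where "A2 = path_edges (a # ys @ [b])"
  define P where "P = path_edges (a # zs @ [b])"
  note d3 = A1_def A2_def P_def
  have ceC: "cycle_edges C = A1 \<union> A2" using xy(5) by (simp add: d3)
  have sub: "A1 \<subseteq> E" "A2 \<subseteq> E" "P \<subseteq> E"
    using C ear(5) unfolding P_def[symmetric] cycle_in_def ceC by auto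
  have disj: "A1 \<inter> A2 = {}" "A1 \<inter> P = {}" "A2 \<inter> P = {}"
    using path_edges_disjoint[OF xy(1,2)] ear(5) unfolding d3[symmetric] ceC by auto
  have d: "distinct (a # b # xs @ ys @ zs)" using xy(1,3) ear(3,4) by auto
  \<comment> \<open>Two paths from \<open>a\<close> to \<open>b\<close> without inner vertices would
    be the same edge, against \<open>disj\<close>.\<close>
  have ne: "xs \<noteq> [] \<or> zs \<noteq> []" "ys \<noteq> [] \<or> zs \<noteq> []"
    using disj(2,3) unfolding d3 by auto
  have "A1 \<noteq> {}" "A2 \<noteq> {}" unfolding d3 by (cases xs; cases ys; simp)+
  have UP: "\<Union>P = set (a # zs @ [b])" unfolding P_def by (rule Union_path_edges) simp
  define X1 where "X1 = img g (A1 \<union> P)"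
  define X2 where "X2 = img g (A2 \<union> P)"
  define X where "X = img g (A1 \<union> A2)"
  have Pin: "img g P \<subseteq> closed_inside X"
    using Ein sub(3) unfolding X_def ceC by (auto simp: img_def)
  have split: "inside X1 \<inter> inside X2 = {}" "inside X1 \<union> inside X2 \<union> (img g P - {p a, p b}) = inside X"
    using theta_split[OF d A1_def A2_def P_def sub disj] Pin unfolding X1_def X2_def X_def by auto
  have Xs: "X1 = img g A1 \<union> img g P" "X2 = img g A2 \<union> img g P" "X = img g A1 \<union> img g A2"
    unfolding X1_def X2_def X_def img_Un by (rule refl)+
  have no_overlap: "inside X1 \<inter> X1 = {}" "inside X2 \<inter> X2 = {}" "inside X \<inter> X = {}" by simp_all
  have "\<Union>A1 \<inter> \<Union>A2 = {a, b}"
    using xy(1) unfolding d3 by (subst (1 2) Union_path_edges) auto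
  then have "img g A1 \<inter> img g A2 \<subseteq> p ` {a, b}" using img_Int[OF sub(1,2) disj(1)] by simp
  moreover have "{a, b} \<subseteq> V" using sub UP edge_subset by (metis UnionE insert_subset list.set_intros(1) empty_subsetI in_set_conv_decomp append_Cons subsetD)
  then have "p ` {a, b} \<subseteq> img g P"
    using vertex_in_img[OF _ sub(3)] by (auto simp: UP)
  ultimately have AAP: "img g A1 \<inter> img g A2 \<subseteq> img g P" by blast
  \<comment> \<open>A point of \<open>A2\<close> inside \<open>X1\<close> would be inside
    \<open>X\<close>, although \<open>A2\<close> is drawn on \<open>X\<close>; likewise for
    \<open>A1\<close> and \<open>X2\<close>. So the closed discs meet only along the ear.\<close>
  have both: "closed_inside X1 \<inter> closed_inside X2 \<subseteq> img g P"
  proof -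
    have "inside X1 \<inter> X2 = {}" "inside X2 \<inter> X1 = {}"
      using split(2) no_overlap unfolding Xs by blast+
    then show ?thesis using split(1) AAP unfolding Xs by blast
  qed
  have cover: "closed_inside X \<subseteq> closed_inside X1 \<union> closed_inside X2"
    using split(2) unfolding Xs by blast
  obtain C1 where C1: "cycle_in (A1 \<union> P) C1" "length C1 = length xs + length zs + 2" "cycle_edges C1 = A1 \<union> P"
    by (rule cycle_joinE[of a b xs zs "A1 \<union> P"]) (use d ne in \<open>auto simp: d3\<close>)
  obtain C2 where C2: "cycle_in (A2 \<union> P) C2" "length C2 = length ys + length zs + 2" "cycle_edges C2 = A2 \<union> P"
    by (rule cycle_joinE[of a b ys zs "A2 \<union> P"]) (use d ne in \<open>auto simp: d3\<close>)
  have CE: "cycle_in E C1" "cycle_in E C2" using C1 C2 sub by (auto simp: cycle_in_def)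
  define E1 where "E1 = {e \<in> E. path_image (g e) \<subseteq> closed_inside X1}"
  define E2 where "E2 = {e \<in> E. path_image (g e) \<subseteq> closed_inside X2}"
  define V1 where "V1 = {v \<in> V. p v \<in> closed_inside X1}"
  define V2 where "V2 = {v \<in> V. p v \<in> closed_inside X2}"
  have e_in: "e \<subseteq> {v \<in> V. p v \<in> S}" if "e \<in> E" "path_image (g e) \<subseteq> S" for e S
    using edge_subset[OF that(1)] edge_vertices[OF that(1)] that(2) by blast
  have d1: "drawing p g V1 E1" and d2: "drawing p g V2 E2"
    unfolding V1_def V2_def E1_def E2_def by (rule subgraph; use e_in in blast)+
  have APE: "A1 \<union> P \<subseteq> E1" "A2 \<union> P \<subseteq> E2"
    using sub unfolding E1_def E2_def Xs by (auto simp: img_def)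
  have EI: "E1 \<inter> E2 = P"
  proof
    show "P \<subseteq> E1 \<inter> E2" using APE by blast
    show "E1 \<inter> E2 \<subseteq> P"
    proof
      fix e assume "e \<in> E1 \<inter> E2"
      then have "e \<in> E" "path_image (g e) \<subseteq> img g P" using both by (auto simp: E1_def E2_def)
      then show "e \<in> P" using edge_in_img sub(3) by blast
    qed
  qed
  have EU: "E1 \<union> E2 = E"
  proof
    show "E1 \<union> E2 \<subseteq> E" by (auto simp: E1_def E2_def)
    show "E \<subseteq> E1 \<union> E2"
    proof
      fix e assume e: "e \<in> E"
      show "e \<in> E1 \<union> E2"
      proof (cases "e \<in> A1 \<union> A2 \<union> P")
        case True
        then show ?thesis using APE by blast
      next
        case False
        \<comment> \<open>Off the three paths, the open edge lies in the union of the two open discs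
          and hence in one of them.\<close>
        have "(path_image (g e) - p ` e) \<inter> img g (A1 \<union> A2 \<union> P) = {}"
          using e sub False by (intro edge_interior_disjoint) auto
        then have "path_image (g e) - p ` e \<subseteq> inside X1 \<union> inside X2"
          using Ein[OF e] split(2) unfolding ceC X_def[symmetric] unfolding Xs img_Un by blast
        then have "path_image (g e) \<subseteq> closure (inside X1) \<or> path_image (g e) \<subseteq> closure (inside X2)"
          using e split(1) cycle_inside_open[OF CE(1)] cycle_inside_open[OF CE(2)]
          unfolding X1_def X2_def C1(3) C2(3) by (intro edge_one_side)
        then show ?thesis
          using e closure_inside_cycle[OF CE(1)] closure_inside_cycle[OF CE(2)]
          unfolding E1_def E2_def X1_def X2_def C1(3) C2(3) by auto
      qed
    qed
  qed
  have VI: "V1 \<inter> V2 = set (a # zs @ [b])"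
  proof
    show "V1 \<inter> V2 \<subseteq> set (a # zs @ [b])"
    proof
      fix v assume "v \<in> V1 \<inter> V2"
      then have "v \<in> V" "p v \<in> img g P" using both by (auto simp: V1_def V2_def)
      then show "v \<in> set (a # zs @ [b])" using vertex_in_img[OF _ sub(3)] UP by blast
    qed
    show "set (a # zs @ [b]) \<subseteq> V1 \<inter> V2"
    proof
      fix v assume "v \<in> set (a # zs @ [b])"
      then obtain e where "e \<in> P" "v \<in> e" unfolding UP[symmetric] by blast
      then show "v \<in> V1 \<inter> V2"
        using EI sgraph_edge_subset[OF drawing.sgraph[OF d1]] sgraph_edge_subset[OF drawing.sgraph[OF d2]]
        by blast
    qed
  qed
  have VU: "V1 \<union> V2 = V"
    using Vin cover unfolding ceC X_def[symmetric] by (auto simp: V1_def V2_def)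
  have finV: "finite V1" "finite V2" "finite E1" "finite E2"
    using fin by (auto simp: V1_def V2_def E1_def E2_def)
  define n where "n = length zs + 1"
  have "card P = n" unfolding P_def n_def using ear(3) by (subst card_path_edges) auto
  then have cE: "card E1 + card E2 = card E + n"
    using card_Un_Int[OF finV(3,4)] unfolding EU EI by simp
  have "card (set (a # zs @ [b])) = n + 1" using distinct_card[OF ear(3)] by (simp add: n_def)
  then have cV: "card V1 + card V2 = card V + n + 1"
    using card_Un_Int[OF finV(1,2)] unfolding VU VI by simp
  \<comment> \<open>\<open>E1\<close> misses \<open>A2\<close> and \<open>E2\<close> misses
    \<open>A1\<close>, which makes both inclusions strict.\<close>
  have psub: "E1 \<subset> E" "E2 \<subset> E"
    using EU EI APE disj \<open>A1 \<noteq> {}\<close> \<open>A2 \<noteq> {}\<close> sub by blast+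
  have cyc: "cycle_in E1 C1" "cycle_in E2 C2" using C1 C2 APE by (auto simp: cycle_in_def)
  show ?thesis
  proof (rule that[OF d1 cyc(1) psub(1) _ _ d2 cyc(2) psub(2) _ _ cE cV])
    show "length C1 + length C2 = length C + 2 * n"
      using C1(2) C2(2) xy(4) by (simp add: n_def)
  qed (auto simp: C1(3) C2(3) X1_def[symmetric] X2_def[symmetric] E1_def E2_def V1_def V2_def)
qed

section \<open>Exchanging the two sides of a cycle by inversion at an inner point\<close>

lemma inversion_outside_subset:
  fixes a :: complex
  assumes X: "simple_path c" "pathfinish c = pathstart c" "X = path_image c"
    and Y: "simple_path d" "pathfinish d = pathstart d" "(\<lambda>z. inverse (z - a)) ` X = path_image d"
    and a: "a \<in> inside X"
  shows "(\<lambda>z. inverse (z - a)) ` outside X \<subseteq> inside ((\<lambda>z. inverse (z - a)) ` X)"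
proof
  define \<phi> where "\<phi> z = inverse (z - a)" for z
  define \<psi> where "\<psi> w = inverse w + a" for w
  \<comment> \<open>As \<open>inverse 0 = 0\<close>, the two maps are mutually inverse everywhere,
    also at the poles \<open>a\<close> and \<open>0\<close>.\<close>
  have \<psi>\<phi>: "\<psi> (\<phi> z) = z" "\<phi> (\<psi> z) = z" for z by (simp_all add: \<phi>_def \<psi>_def)
  let ?O = "outside (\<phi> ` X)"
  note JX = Jordan_inside_outside[OF X(1,2), folded X(3)]
  note JY = Jordan_inside_outside[OF Y(1,2), folded Y(3), folded \<phi>_def]
  fix w assume "w \<in> (\<lambda>z. inverse (z - a)) ` outside X"
  then obtain z where z: "z \<in> outside X" "w = \<phi> z" by (auto simp: \<phi>_def)
  have "z \<noteq> a" using z(1) a JX by blast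
  then have "\<phi> z \<noteq> 0" by (simp add: \<phi>_def)
  \<comment> \<open>Otherwise \<psi> maps the connected set \<open>?O - {0}\<close> off
    \<open>X\<close>, hence to one side of \<open>X\<close>. But its image contains
    \<open>z\<close>, which is outside \<open>X\<close>, and also points near \<open>a\<close>,
    which are inside: they come from points of large norm in the unbounded
    \<open>?O\<close>.\<close>
  have "w \<in> inside (\<phi> ` X)"
  proof (rule ccontr)
    assume "w \<notin> inside (\<phi> ` X)"
    moreover have "w \<notin> \<phi> ` X"
    proof
      assume "w \<in> \<phi> ` X"
      then have "z \<in> X" using z(2) \<psi>\<phi>(1) by (metis imageE)
      then show False using z(1) outside_no_overlap by blast
    qed
    ultimately have wO: "w \<in> ?O" using JY by blast
    have "Topological_Spaces.connected (?O - {0})" using JY by (intro connected_open_delete) auto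
    moreover have "continuous_on (?O - {0}) \<psi>" unfolding \<psi>_def by (intro continuous_intros) auto
    ultimately have conn: "Topological_Spaces.connected (\<psi> ` (?O - {0}))"
      by (rule connected_continuous_image[rotated])
    have "\<psi> ` (?O - {0}) \<inter> X = {}"
    proof (rule ccontr)
      assume "\<psi> ` (?O - {0}) \<inter> X \<noteq> {}"
      then obtain v where "v \<in> ?O" "\<psi> v \<in> X" by blast
      then have "v \<in> \<phi> ` X" using \<psi>\<phi>(2) by (metis imageI)
      then show False using \<open>v \<in> ?O\<close> outside_no_overlap by blast
    qed
    then have sub: "\<psi> ` (?O - {0}) \<subseteq> inside X \<union> outside X" using JX by blast
    have "z \<in> \<psi> ` (?O - {0})"
      by (rule image_eqI[of _ _ w]) (use wO z(2) \<psi>\<phi>(1) \<open>\<phi> z \<noteq> 0\<close> in auto)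
    moreover obtain r where r: "r > 0" "ball a r \<subseteq> inside X"
      using JX a by (meson open_contains_ball)
    obtain v where v: "v \<in> ?O" "norm v > 1 / r"
      using JY unfolding bounded_iff by (meson not_le)
    then have "norm v > 0" using r(1) by (meson divide_pos_pos less_trans zero_less_one)
    then have "norm (inverse v) < r" using v(2) r(1) by (simp add: norm_inverse norm_divide field_simps)
    then have "\<psi> v \<in> inside X" using r(2) by (auto simp: \<psi>_def dist_norm)
    moreover have "\<psi> v \<in> \<psi> ` (?O - {0})" using v \<open>norm v > 0\<close> by auto
    moreover have "inside X \<inter> \<psi> ` (?O - {0}) = {} \<or> outside X \<inter> \<psi> ` (?O - {0}) = {}"
      by (rule connectedD[OF conn _ _ _ sub]) (use JX in auto)
    ultimately show False using z(1) by (meson disjoint_iff)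
  qed
  then show "w \<in> inside ((\<lambda>z. inverse (z - a)) ` X)" unfolding \<phi>_def .
qed

lemma (in drawing) drawing_compose:
  assumes "continuous_on S \<phi>" "inj_on \<phi> S" "p ` V \<subseteq> S" "\<And>e. e \<in> E \<Longrightarrow> path_image (g e) \<subseteq> S"
  shows "drawing (\<phi> \<circ> p) (\<lambda>e. \<phi> \<circ> g e) V E"
proof
  show "sgraph V E" by (rule sgraph)
  show "inj_on (\<phi> \<circ> p) V" using inj assms(2,3) by (intro comp_inj_on) (auto intro: inj_on_subset)
  fix e assume e: "e \<in> E"
  have "path (\<phi> \<circ> g e)"
    using path_continuous_image[OF arc_imp_path[OF arc_edge[OF e]]] assms(1) assms(4)[OF e]
    by (meson continuous_on_subset)
  moreover have "inj_on (\<phi> \<circ> g e) {0..1}"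
    using arc_imp_inj_on[OF arc_edge[OF e]] assms(2) assms(4)[OF e]
    by (intro comp_inj_on) (auto simp: path_image_def intro: inj_on_subset)
  ultimately show "arc (\<phi> \<circ> g e)" by (simp add: arc_def)
  show "{pathstart (\<phi> \<circ> g e), pathfinish (\<phi> \<circ> g e)} = (\<phi> \<circ> p) ` e"
    unfolding image_comp[symmetric] edge_ends[OF e, symmetric]
    by (simp add: pathstart_compose pathfinish_compose)
  have "path_image (\<phi> \<circ> g e) \<inter> (\<phi> \<circ> p) ` V = \<phi> ` (path_image (g e) \<inter> p ` V)"
    using inj_on_image_Int[OF assms(2,4,3)] e by (simp add: path_image_compose image_comp)
  then show "path_image (\<phi> \<circ> g e) \<inter> (\<phi> \<circ> p) ` V = (\<phi> \<circ> p) ` e"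
    by (simp add: edge_vertices[OF e] image_comp)
  fix f assume f: "f \<in> E" "e \<noteq> f"
  have "path_image (\<phi> \<circ> g e) \<inter> path_image (\<phi> \<circ> g f) = \<phi> ` (path_image (g e) \<inter> path_image (g f))"
    using inj_on_image_Int[OF assms(2,4) assms(4)] e f by (simp add: path_image_compose)
  then show "path_image (\<phi> \<circ> g e) \<inter> path_image (\<phi> \<circ> g f) \<subseteq> (\<phi> \<circ> p) ` (e \<inter> f)"
    unfolding image_comp[symmetric] using edge_edge[OF e f(1,2)] by (simp add: image_mono)
qed

text \<open>The cycle \<open>C\<close> divides the graph into two parts that share exactly
  \<open>C\<close>. The hypothesis \<open>bound\<close> speaks of arbitrary drawings because the
  outer part is redrawn by the inversion. When the two bounds are added, the terms in
  \<open>length C\<close> cancel.\<close>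

lemma (in drawing) card_edges_by_sides:
  assumes C: "cycle_in E C" and k: "2 \<le> k"
    and bound: "\<And>p' g' V' E'. drawing p' g' V' E' \<Longrightarrow> E' \<subseteq> E \<Longrightarrow> cycle_in E' C \<Longrightarrow>
      (\<And>e. e \<in> E' \<Longrightarrow> path_image (g' e) \<subseteq> closed_inside (img g' (cycle_edges C))) \<Longrightarrow>
      (\<And>v. v \<in> V' \<Longrightarrow> p' v \<in> closed_inside (img g' (cycle_edges C))) \<Longrightarrow>
      (k - 2) * card E' + k + length C \<le> k * card V'"
  shows "(k - 2) * card E + k \<le> k * card V"
proof -
  have fin: "finite V" "finite E" using sgraph sgraph_finite_edges[OF sgraph] by (auto simp: sgraph_def)
  define F where "F = cycle_edges C"
  have FE: "F \<subseteq> E" using C by (simp add: cycle_in_def F_def)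
  define X where "X = img g F"
  obtain c where c: "simple_path c" "pathfinish c = pathstart c" "X = path_image c"
    using cycle_Jordan[OF C] unfolding X_def F_def by metis
  note J = Jordan_inside_outside[OF c(1,2), folded c(3)]
  obtain a where a: "a \<in> inside X" using J by blast
  define \<phi> where "\<phi> = (\<lambda>z. inverse (z - a))"
  define E1 where "E1 = {e \<in> E. path_image (g e) \<subseteq> closed_inside X}"
  define E2 where "E2 = {e \<in> E. path_image (g e) \<subseteq> X \<union> outside X}"
  define V1 where "V1 = {v \<in> V. p v \<in> closed_inside X}"
  define V2 where "V2 = {v \<in> V. p v \<in> X \<union> outside X}"
  have e_in: "e \<subseteq> {v \<in> V. p v \<in> S}" if "e \<in> E" "path_image (g e) \<subseteq> S" for e S
    using edge_subset[OF that(1)] edge_vertices[OF that(1)] that(2) by blast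
  have d1: "drawing p g V1 E1" and d2: "drawing p g V2 E2"
    unfolding V1_def V2_def E1_def E2_def by (rule subgraph; use e_in in blast)+
  have F12: "F \<subseteq> E1" "F \<subseteq> E2" using FE by (auto simp: E1_def E2_def X_def img_def)
  have cyc: "cycle_in E1 C" "cycle_in E2 C"
    using C F12 by (auto simp: cycle_in_def F_def)
  have b1: "(k - 2) * card E1 + k + length C \<le> k * card V1"
    by (rule bound[OF d1 _ cyc(1)]) (auto simp: E1_def V1_def X_def F_def)
  \<comment> \<open>The pole \<open>a\<close> lies strictly inside \<open>C\<close>, away from the
    outer part, so \<phi> is continuous there.\<close>
  have d3: "drawing (\<phi> \<circ> p) (\<lambda>e. \<phi> \<circ> g e) V2 E2"
  proof (rule drawing.drawing_compose[OF d2, of "X \<union> outside X"])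
    have "a \<notin> X \<union> outside X" using a J by blast
    then show "continuous_on (X \<union> outside X) \<phi>"
      unfolding \<phi>_def by (intro continuous_intros) auto
    show "inj_on \<phi> (X \<union> outside X)" by (auto simp: inj_on_def \<phi>_def)
  qed (auto simp: V2_def E2_def)
  have img': "img (\<lambda>e. \<phi> \<circ> g e) F = \<phi> ` X"
    by (auto simp: img_def X_def path_image_compose)
  obtain d where d: "simple_path d" "pathfinish d = pathstart d" "\<phi> ` X = path_image d"
    using drawing.cycle_Jordan[OF d3 cyc(2)] unfolding F_def[symmetric] img' by metis
  have out: "\<phi> ` (X \<union> outside X) \<subseteq> closed_inside (\<phi> ` X)"
    using inversion_outside_subset[OF c d(1,2) d(3)[unfolded \<phi>_def] a] unfolding \<phi>_def by blast
  have b2: "(k - 2) * card E2 + k + length C \<le> k * card V2"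
  proof (rule bound[OF d3 _ cyc(2)])
    show "path_image (\<phi> \<circ> g e) \<subseteq> closed_inside (img (\<lambda>e. \<phi> \<circ> g e) (cycle_edges C))" if "e \<in> E2" for e
      using that out unfolding F_def[symmetric] img' E2_def path_image_compose by blast
    show "(\<phi> \<circ> p) v \<in> closed_inside (img (\<lambda>e. \<phi> \<circ> g e) (cycle_edges C))" if "v \<in> V2" for v
    proof -
      have "\<phi> (p v) \<in> \<phi> ` (X \<union> outside X)" using that unfolding V2_def by blast
      then show ?thesis using out unfolding F_def[symmetric] img' comp_apply by (rule subsetD[rotated])
    qed
  qed (auto simp: E2_def)
  have meet: "closed_inside X \<inter> (X \<union> outside X) \<subseteq> X" using J by blast
  have EI: "E1 \<inter> E2 = F"
  proof
    show "F \<subseteq> E1 \<inter> E2" using F12 by blast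
    show "E1 \<inter> E2 \<subseteq> F"
    proof
      fix e assume "e \<in> E1 \<inter> E2"
      then have "e \<in> E" "path_image (g e) \<subseteq> img g F"
        using meet unfolding E1_def E2_def X_def by blast+
      then show "e \<in> F" using edge_in_img FE by blast
    qed
  qed
  have EU: "E1 \<union> E2 = E"
  proof
    show "E1 \<union> E2 \<subseteq> E" by (auto simp: E1_def E2_def)
    show "E \<subseteq> E1 \<union> E2"
    proof
      fix e assume e: "e \<in> E"
      show "e \<in> E1 \<union> E2"
      proof (cases "e \<in> F")
        case False
        have "path_image (g e) - p ` e \<subseteq> inside X \<union> outside X"
          using edge_interior_disjoint[OF e FE False] J unfolding X_def[symmetric] by blast
        then have "path_image (g e) \<subseteq> closure (inside X) \<or> path_image (g e) \<subseteq> closure (outside X)"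
          using e J by (intro edge_one_side) auto
        moreover have "closure (inside X) = closed_inside X" "closure (outside X) = X \<union> outside X"
          using J closure_Un_frontier[of "inside X"] closure_Un_frontier[of "outside X"] by auto
        ultimately show ?thesis using e by (auto simp: E1_def E2_def)
      qed (use F12 in blast)
    qed
  qed
  have UF: "\<Union>F = set C" unfolding F_def by (rule Union_cycle_edges[OF C])
  have VI: "V1 \<inter> V2 = set C"
  proof
    show "V1 \<inter> V2 \<subseteq> set C"
    proof
      fix v assume "v \<in> V1 \<inter> V2"
      then have "v \<in> V" "p v \<in> img g F" using meet unfolding V1_def V2_def X_def by blast+
      then show "v \<in> set C" using vertex_in_img[OF _ FE] UF by blast
    qed
    show "set C \<subseteq> V1 \<inter> V2"
      using F12 drawing.edge_subset[OF d1] drawing.edge_subset[OF d2] unfolding UF[symmetric] by blast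
  qed
  have VU: "V1 \<union> V2 = V" using J unfolding V1_def V2_def by blast
  have finV: "finite V1" "finite V2" "finite E1" "finite E2"
    using fin by (auto simp: V1_def V2_def E1_def E2_def)
  have cE: "card E1 + card E2 = card E + length C"
    using card_Un_Int[OF finV(3,4)] card_cycle_edges[OF C] unfolding EU EI F_def by simp
  have cV: "card V1 + card V2 = card V + length C"
    using card_Un_Int[OF finV(1,2)] distinct_card[of C] C unfolding VU VI cycle_in_def by simp
  obtain m where m: "k = m + 2" using k by (metis add.commute le_Suc_ex)
  have "m * (card E1 + card E2) + 2 * k + 2 * length C \<le> k * (card V1 + card V2)"
    using b1 b2 unfolding m by (simp add: algebra_simps)
  then show ?thesis unfolding cE cV unfolding m by (simp add: algebra_simps)
qed

text \<open>The induction on \<open>card E\<close> carries the disc bound along with the general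
  one: the disc bound needs both for fewer edges, the general bound needs the disc bound for at most
  as many.\<close>

theorem drawing_girth_bound:
  fixes E :: "'a set set"
  assumes "drawing p g V E" "V \<noteq> {}" "2 \<le> k" "\<And>C. cycle_in E C \<Longrightarrow> k \<le> length C"
  shows "(k - 2) * card E + k \<le> k * card V"
proof -
  have "(V \<noteq> {} \<longrightarrow> (k - 2) * card E + k \<le> k * card V) \<and>
    (\<forall>C. cycle_in E C \<longrightarrow> (\<forall>e\<in>E. path_image (g e) \<subseteq> closed_inside (img g (cycle_edges C))) \<longrightarrow>
      (\<forall>v\<in>V. p v \<in> closed_inside (img g (cycle_edges C))) \<longrightarrow>
      (k - 2) * card E + k + length C \<le> k * card V)"
    if "drawing p g V E" "\<And>C. cycle_in E C \<Longrightarrow> k \<le> length C" for p g V and E :: "'a set set"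
    using that
  proof (induction "card E" arbitrary: p g V E rule: less_induct)
    case less
    have fin: "finite E'" if "drawing p g V E'" for p g V and E' :: "'a set set"
      using sgraph_finite_edges drawing.sgraph that by blast
    \<comment> \<open>Stated for every \<open>E' \<subseteq> E\<close> and every drawing, since one
      side of a cycle may carry all of \<open>E\<close>; only proper subsets of \<open>E'\<close>
      are handed to the induction hypothesis.\<close>
    have inner: "(k - 2) * card E' + k + length C \<le> k * card V'"
      if d: "drawing p' g' V' E'" and sub: "E' \<subseteq> E" and C: "cycle_in E' C"
        and Ein: "\<And>e. e \<in> E' \<Longrightarrow> path_image (g' e) \<subseteq> closed_inside (img g' (cycle_edges C))"
        and Vin: "\<And>v. v \<in> V' \<Longrightarrow> p' v \<in> closed_inside (img g' (cycle_edges C))"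
      for p' g' V' E' C
    proof -
      have le: "card E' \<le> card E" by (rule card_mono[OF fin[OF less.prems(1)] sub])
      have girth: "k \<le> length D" if "cycle_in E'' D" "E'' \<subseteq> E'" for E'' D
        using less.prems(2)[of D] that sub by (auto simp: cycle_in_def)
      have lt: "card E'' < card E" if "E'' \<subset> E'" for E''
        using psubset_card_mono[OF fin[OF d] that] le by simp
      show ?thesis
      proof (cases "\<exists>a b. a \<in> set C \<and> b \<in> set C \<and> a \<noteq> b \<and> (a, b) \<in> {(x, y). {x, y} \<in> E' - cycle_edges C}\<^sup>*")
        case True
        then obtain a0 b0 where "a0 \<in> set C" "b0 \<in> set C" "a0 \<noteq> b0"
          "(a0, b0) \<in> {(x, y). {x, y} \<in> E' - cycle_edges C}\<^sup>*" by blast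
        then obtain a zs b where ear: "a \<in> set C" "b \<in> set C" "distinct (a # zs @ [b])"
          "set zs \<inter> set C = {}" "path_edges (a # zs @ [b]) \<subseteq> E' - cycle_edges C"
          by (metis reachable_imp_ear)
        show ?thesis
        proof (rule drawing.ear_split[OF d C Ein Vin ear])
          fix V1 E1 C1 V2 E2 C2 n
          assume 1: "drawing p' g' V1 E1" "cycle_in E1 C1" "E1 \<subset> E'"
            "\<And>e. e \<in> E1 \<Longrightarrow> path_image (g' e) \<subseteq> closed_inside (img g' (cycle_edges C1))"
            "\<And>v. v \<in> V1 \<Longrightarrow> p' v \<in> closed_inside (img g' (cycle_edges C1))"
            and 2: "drawing p' g' V2 E2" "cycle_in E2 C2" "E2 \<subset> E'"
            "\<And>e. e \<in> E2 \<Longrightarrow> path_image (g' e) \<subseteq> closed_inside (img g' (cycle_edges C2))"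
            "\<And>v. v \<in> V2 \<Longrightarrow> p' v \<in> closed_inside (img g' (cycle_edges C2))"
            and cards: "card E1 + card E2 = card E' + n" "card V1 + card V2 = card V' + n + 1"
            "length C1 + length C2 = length C + 2 * n"
          have "(k - 2) * card E1 + k + length C1 \<le> k * card V1"
            using less.hyps[OF lt[OF 1(3)] 1(1)] girth 1 by blast
          moreover have "(k - 2) * card E2 + k + length C2 \<le> k * card V2"
            using less.hyps[OF lt[OF 2(3)] 2(1)] girth 2 by blast
          ultimately have "(k - 2) * (card E1 + card E2) + 2 * k + (length C1 + length C2) \<le> k * (card V1 + card V2)"
            by (simp add: distrib_left)
          moreover obtain m where m: "k = m + 2" using assms(3) by (metis add.commute le_Suc_ex)
          ultimately show ?thesis unfolding cards unfolding m by (simp add: algebra_simps)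
        qed
      next
        case False
        show ?thesis
        proof (rule card_edges_no_ear[OF drawing.sgraph[OF d] C assms(3) girth[OF C]])
          fix V'' E'' assume *: "V'' \<subseteq> V'" "E'' \<subset> E'" "V'' \<noteq> {}" "\<And>e. e \<in> E'' \<Longrightarrow> e \<subseteq> V''"
          have "drawing p' g' V'' E''"
            by (rule drawing.subgraph[OF d *(1) _ *(4)]) (use *(2) in blast)
          then show "(k - 2) * card E'' + k \<le> k * card V''"
            using less.hyps[OF lt[OF *(2)]] girth *(2,3) by blast
        qed (use False in blast)+
      qed
    qed
    have "(k - 2) * card E + k \<le> k * card V" if "V \<noteq> {}"
    proof (cases "\<exists>C. cycle_in E C")
      case True
      then obtain C where "cycle_in E C" ..
      show ?thesis
      proof (rule drawing.card_edges_by_sides[OF less.prems(1) \<open>cycle_in E C\<close> assms(3)])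
        fix p' g' V' E'
        assume "drawing p' g' V' E'" "E' \<subseteq> E" "cycle_in E' C"
          "\<And>e. e \<in> E' \<Longrightarrow> path_image (g' e) \<subseteq> closed_inside (img g' (cycle_edges C))"
          "\<And>v. v \<in> V' \<Longrightarrow> p' v \<in> closed_inside (img g' (cycle_edges C))"
        then show "(k - 2) * card E' + k + length C \<le> k * card V'" by (rule inner)
      qed
    next
      case False
      then have "card E + 1 \<le> card V"
        using forest_card[OF drawing.sgraph[OF less.prems(1)] that] by blast
      then have "k * (card E + 1) \<le> k * card V" by (rule mult_le_mono2)
      moreover have "(k - 2) * card E \<le> k * card E" by (rule mult_le_mono1) simp
      ultimately show ?thesis unfolding distrib_left by linarith
    qed
    then show ?case using inner[OF less.prems(1) subset_refl] by blast
  qed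
  then show ?thesis using assms by blast
qed

section \<open>Orientations and inversions\<close>

definition uedges :: "'a pair_pre_digraph \<Rightarrow> 'a set set" where
  "uedges G = {{u, v} |u v. (u, v) \<in> parcs G}"

lemma (in pair_graph) parcs_sym: "(u, v) \<in> parcs G \<Longrightarrow> (v, u) \<in> parcs G"
  using sym_arcs by (auto simp: symmetric_def sym_def)

lemma (in pair_graph) in_uedges_iff: "{u, v} \<in> uedges G \<longleftrightarrow> (u, v) \<in> parcs G"
  using parcs_sym by (auto simp: uedges_def doubleton_eq_iff)

lemma (in pair_graph) sgraph_uedges: "sgraph (pverts G) (uedges G)"
  unfolding sgraph_def
proof (intro conjI ballI)
  show "finite (pverts G)" by simp
  fix e assume "e \<in> uedges G"
  then obtain u v where uv: "(u, v) \<in> parcs G" "e = {u, v}" by (auto simp: uedges_def)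
  moreover have "u \<noteq> v" using no_loops[of "(u, v)"] uv(1) by auto
  moreover have "u \<in> pverts G" "v \<in> pverts G" using wellformed[of "(u, v)"] uv(1) by auto
  ultimately show "\<exists>u\<in>pverts G. \<exists>v\<in>pverts G. u \<noteq> v \<and> e = {u, v}" by blast
qed

lemma (in pair_graph) walk_arcs_awalk:
  assumes "path_edges (v # vs) \<subseteq> uedges G" "v \<in> pverts G"
  shows "\<exists>as. awalk v as (last (v # vs)) \<and> awalk_verts v as = v # vs \<and> length as = length vs"
  using assms
proof (induction vs arbitrary: v)
  case Nil
  then show ?case by (intro exI[of _ "[]"]) (simp add: awalk_Nil_iff)
next
  case (Cons w vs)
  have vw: "(v, w) \<in> parcs G" using Cons.prems(1) by (simp add: in_uedges_iff)
  then have "w \<in> pverts G" using wellformed[of "(v, w)"] by auto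
  then obtain as where "awalk w as (last (w # vs))" "awalk_verts w as = w # vs" "length as = length vs"
    using Cons by (metis insert_subset path_edges.simps(1))
  then show ?case using vw by (intro exI[of _ "(v, w) # as"]) (simp add: awalk_Cons_iff)
qed

text \<open>A cycle of the library is a list of arcs whose vertex list repeats its start, so
  \<open>C @ [hd C]\<close> yields one with \<open>length C\<close> arcs.\<close>

lemma (in pair_graph) girth_le_cycle:
  assumes "cycle_in (uedges G) C"
  shows "girth (with_proj G) \<le> enat (length C)"
proof -
  obtain v vs where C: "C = v # vs" using assms by (cases C) (auto simp: cycle_in_def)
  have pe: "path_edges (v # vs @ [v]) \<subseteq> uedges G" using assms C by (simp add: cycle_in_def cycle_edges_def)
  have "\<Union>(cycle_edges C) = set C" by (rule Union_cycle_edges[OF assms])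
  then have "v \<in> pverts G"
    using assms sgraph_edge_subset[OF sgraph_uedges] C unfolding cycle_in_def by (metis UnionE list.set_intros(1) subsetD)
  from walk_arcs_awalk[OF pe this] obtain as where as:
    "awalk v as v" "awalk_verts v as = v # vs @ [v]" "length as = length C" by (auto simp: C)
  have "cycle as"
    unfolding cycle_def using as assms C by (intro exI[of _ v]) (auto simp: cycle_in_def)
  moreover have "3 \<le> length as" using as(3) assms by (simp add: cycle_in_def)
  ultimately show ?thesis unfolding girth_def as(3)[symmetric] by (intro INF_lower) simp
qed

lemma (in pair_graph) drawing_plane_drawing:
  assumes "plane_drawing G p g"
  shows "drawing p g (pverts G) (uedges G)"
proof
  show "sgraph (pverts G) (uedges G)" by (rule sgraph_uedges)
  show "inj_on p (pverts G)" using assms by (simp add: plane_drawing_def)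
  fix e assume "e \<in> uedges G"
  then obtain u v where uv: "(u, v) \<in> parcs G" "e = {u, v}" by (auto simp: uedges_def)
  have "Path_Connected.arc (g {u, v}) \<and>
      {pathstart (g {u, v}), pathfinish (g {u, v})} = {p u, p v} \<and>
      path_image (g {u, v}) \<inter> p ` pverts G = {p u, p v}"
    using assms uv(1) unfolding plane_drawing_def by (elim conjE) (drule (1) bspec, simp)
  then show "Path_Connected.arc (g e)" "{pathstart (g e), pathfinish (g e)} = p ` e"
    "path_image (g e) \<inter> p ` pverts G = p ` e"
    unfolding uv(2) image_insert image_empty by blast+
  fix f assume "f \<in> uedges G" "e \<noteq> f"
  then obtain x y where xy: "(x, y) \<in> parcs G" "f = {x, y}" by (auto simp: uedges_def)
  have "\<forall>(u, v)\<in>parcs G. \<forall>(x, y)\<in>parcs G. {u, v} \<noteq> {x, y} \<longrightarrow>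
      path_image (g {u, v}) \<inter> path_image (g {x, y}) \<subseteq> p ` ({u, v} \<inter> {x, y})"
    using assms unfolding plane_drawing_def by (elim conjE)
  from bspec[OF bspec[OF this uv(1), unfolded split] xy(1), unfolded split]
  show "path_image (g e) \<inter> path_image (g f) \<subseteq> p ` (e \<inter> f)"
    using \<open>e \<noteq> f\<close> unfolding uv(2) xy(2) by (rule mp)
qed

text \<open>An orientation has exactly one of the two arcs of an edge, so reversal negates
  membership: over F_2, inverting \<open>X\<close> adds the product of the indicators of
  \<open>X\<close> at both ends.\<close>

lemma in_inversion_iff:
  assumes "orientation G D" "(u, v) \<in> parcs G"
  shows "(u, v) \<in> parcs (inversion X D) \<longleftrightarrow> (((u, v) \<in> parcs D) \<noteq> (u \<in> X \<and> v \<in> X))"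
  using assms by (auto simp: orientation_def inversion_def)

lemma (in pair_graph) orientation_inversion:
  assumes "orientation G D"
  shows "orientation G (inversion X D)"
  unfolding orientation_def
proof (intro conjI)
  show "pverts (inversion X D) = pverts G" using assms by (simp add: inversion_def orientation_def)
  show "parcs (inversion X D) \<subseteq> parcs G"
    using assms parcs_sym by (auto simp: inversion_def orientation_def split: if_splits)
  show "\<forall>(u, v)\<in>parcs G. ((u, v) \<in> parcs (inversion X D)) = ((v, u) \<notin> parcs (inversion X D))"
  proof clarify
    fix u v assume uv: "(u, v) \<in> parcs G"
    then have "(u, v) \<in> parcs D \<longleftrightarrow> (v, u) \<notin> parcs D" using assms by (auto simp: orientation_def)
    then show "((u, v) \<in> parcs (inversion X D)) = ((v, u) \<notin> parcs (inversion X D))"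
      using in_inversion_iff[OF assms uv] in_inversion_iff[OF assms parcs_sym[OF uv]] by auto
  qed
qed

text \<open>The inversion graph has no loops, so an inversion that fixes \<open>D\<close>
  corresponds to the empty walk; hence an inequality for the length.\<close>

lemma (in pair_graph) inversion_awalk:
  assumes "orientation G D" "X \<subseteq> pverts G"
  shows "\<exists>as. pre_digraph.awalk (with_proj (inversion_graph G)) D as (inversion X D) \<and> length as \<le> 1"
proof -
  interpret I: pair_graph "inversion_graph G" by (rule pair_graph_inversion_graph) unfold_locales
  have D: "D \<in> pverts (inversion_graph G)" "inversion X D \<in> pverts (inversion_graph G)"
    using assms(1) orientation_inversion by (auto simp: inversion_graph_def)
  show ?thesis
  proof (cases "inversion X D = D")
    case True
    then show ?thesis using D by (intro exI[of _ "[]"]) (simp add: I.awalk_Nil_iff)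
  next
    case False
    then have "(D, inversion X D) \<in> parcs (inversion_graph G)"
      using assms orientation_inversion by (auto simp: inversion_graph_def)
    then show ?thesis
      using D by (intro exI[of _ "[(D, inversion X D)]"]) (simp add: I.awalk_Cons_iff I.awalk_Nil_iff)
  qed
qed

theorem theorem8p8:
  fixes G :: "'a pair_pre_digraph"
  assumes "pair_graph G"
    and "planar G"
    and "8 \<le> girth (with_proj G)"
  shows "diam (with_proj (inversion_graph G)) \<le> 3"
proof -
  interpret pair_graph G by fact
  interpret I: pair_graph "inversion_graph G" by (rule pair_graph_inversion_graph) fact
  obtain p g where "plane_drawing G p g" using assms(2) by (auto simp: planar_def)
  then have dr: "drawing p g (pverts G) (uedges G)" by (rule drawing_plane_drawing)
  have girth: "8 \<le> length C" if "cycle_in (uedges G) C" for C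
  proof -
    have "enat 8 \<le> enat (length C)"
      using order_trans[OF assms(3) girth_le_cycle[OF that]] by (simp add: numeral_eq_enat)
    then show ?thesis by simp
  qed
  \<comment> \<open>Subgraphs inherit the bound on cycle lengths. For \<open>k = 8\<close> the edge
    bound reads \<open>6 * card E + 8 \<le> 8 * card W\<close>, with \<open>E\<close> the edges
    within \<open>W\<close>; halving it gives the strict inequality.\<close>
  have sparse: "3 * card {e \<in> uedges G. e \<subseteq> W} < 4 * card W" if W: "W \<subseteq> pverts G" "W \<noteq> {}" for W
  proof -
    have "drawing p g W {e \<in> uedges G. e \<subseteq> W}"
      by (rule drawing.subgraph[OF dr]) (use W in auto)
    then have "(8 - 2) * card {e \<in> uedges G. e \<subseteq> W} + 8 \<le> 8 * card W"
      by (rule drawing_girth_bound) (use W girth in \<open>auto simp: cycle_in_def\<close>)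
    then show ?thesis by simp
  qed
  have "I.\<mu> (\<lambda>_. 1) D D' \<le> 3" if D: "orientation G D" and D': "orientation G D'" for D D'
  proof -
    \<comment> \<open>\<open>q\<close> marks the edges on which \<open>D\<close> and
      \<open>D'\<close> disagree: on such an edge exactly one of the two arcs is in \<open>D\<close>
      and not in \<open>D'\<close>, so the order of the ends is immaterial.\<close>
    define q where "q e \<longleftrightarrow> (\<exists>u v. e = {u, v} \<and> (u, v) \<in> parcs D \<and> (u, v) \<notin> parcs D')" for e
    obtain x where x: "\<And>u v. {u, v} \<in> uedges G \<Longrightarrow> dot (x u) (x v) = q {u, v}"
      using sparse_imp_labelling[OF sgraph_uedges sparse, of q] by blast
    \<comment> \<open>The intersection with \<open>pverts G\<close> is there because
      \<open>inversion_graph\<close> admits only sets of vertices of \<open>G\<close>.\<close>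
    define X1 where "X1 = {v \<in> pverts G. fst (x v)}"
    define X2 where "X2 = {v \<in> pverts G. fst (snd (x v))}"
    define X3 where "X3 = {v \<in> pverts G. snd (snd (x v))}"
    define D1 where "D1 = inversion X1 D"
    define D2 where "D2 = inversion X2 D1"
    define D3 where "D3 = inversion X3 D2"
    have o1: "orientation G D1" unfolding D1_def by (rule orientation_inversion[OF D])
    have o2: "orientation G D2" unfolding D2_def by (rule orientation_inversion[OF o1])
    have o3: "orientation G D3" unfolding D3_def by (rule orientation_inversion[OF o2])
    have arcs: "(u, v) \<in> parcs D3 \<longleftrightarrow> (u, v) \<in> parcs D'" if uv: "(u, v) \<in> parcs G" for u v
    proof -
      have "u \<in> pverts G" "v \<in> pverts G" using wellformed[of "(u, v)"] uv by auto
      then have "dot (x u) (x v) \<longleftrightarrow>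
          ((u \<in> X1 \<and> v \<in> X1) \<noteq> ((u \<in> X2 \<and> v \<in> X2) \<noteq> (u \<in> X3 \<and> v \<in> X3)))"
        by (cases "x u"; cases "x v") (simp add: X1_def X2_def X3_def)
      moreover have "q {u, v} \<longleftrightarrow> (((u, v) \<in> parcs D) \<noteq> ((u, v) \<in> parcs D'))"
      proof -
        have "(v, u) \<in> parcs D \<longleftrightarrow> (u, v) \<notin> parcs D" "(v, u) \<in> parcs D' \<longleftrightarrow> (u, v) \<notin> parcs D'"
          using D D' uv unfolding orientation_def by auto
        then show ?thesis unfolding q_def by (metis doubleton_eq_iff)
      qed
      moreover have "dot (x u) (x v) = q {u, v}" using x uv by (simp add: in_uedges_iff)
      \<comment> \<open>The three inversions add up to the dot product, which is
        \<open>q {u, v}\<close>; so exactly the edges of disagreement end up reversed.\<close>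
      ultimately show ?thesis
        unfolding D3_def in_inversion_iff[OF o2 uv]
        unfolding D2_def in_inversion_iff[OF o1 uv]
        unfolding D1_def in_inversion_iff[OF D uv] by argo
    qed
    have "parcs D3 = parcs D'" using arcs o3 D' unfolding orientation_def by auto
    then have "D3 = D'" using o3 D' by (auto simp: orientation_def)
    obtain as where as: "I.awalk D as D1" "length as \<le> 1"
      using inversion_awalk[OF D, of X1] unfolding D1_def X1_def by blast
    obtain bs where bs: "I.awalk D1 bs D2" "length bs \<le> 1"
      using inversion_awalk[OF o1, of X2] unfolding D2_def X2_def by blast
    obtain cs where cs: "I.awalk D2 cs D3" "length cs \<le> 1"
      using inversion_awalk[OF o2, of X3] unfolding D3_def X3_def by blast
    have "I.awalk D (as @ bs @ cs) D'"
      using as bs cs \<open>D3 = D'\<close> I.awalk_appendI by metis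
    then have "I.\<mu> (\<lambda>_. 1) D D' \<le> ereal (I.awalk_cost (\<lambda>_. 1) (as @ bs @ cs))"
      by (rule I.min_cost_le_walk_cost)
    also have "\<dots> = ereal (real (length (as @ bs @ cs)))"
      by (simp only: I.awalk_cost_def map_replicate_const sum_list_replicate) simp
    also have "\<dots> \<le> ereal 3" using as(2) bs(2) cs(2) by simp
    finally show ?thesis by simp
  qed
  then show ?thesis
    unfolding diam_def by (intro SUP_least) (auto simp: inversion_graph_def)
qed

end
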